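(* Let $n\ge2$, $1<p<n$, $p^*=\frac{np}{n-p}$, let $\Omega\subset\mathbb{R}^n$ be a bounded convex domain, let $H$ be a norm with $H^2\in C^2(\mathbb{R}^n\setminus\{0\})\cap C^{1,1}(\mathbb{R}^n)$ satisfying $\lambda\,\mathrm{Id}\le HD^2H+\nabla H\otimes\nabla H\le\Lambda\,\mathrm{Id}$ on $\mathbb{R}^n\setminus\{0\}$ for some $0<\lambda\le\Lambda$, and let $f\in C^1(\mathbb{R})$ be such that $t\mapsto f(t)/t^{p^*-1}$ is nonincreasing on $(0,\infty)$. Then every positive bounded weak solution $u$ of $$\begin{cases}\operatorname{div}(a(\nabla u))+f(u)=0 & \text{in }\Omega,\\ |\nabla u|=0 & \text{on }\partial\Omega\end{cases}$$ is constant.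
   Context: A "norm" (gauge) $H$ on $\mathbb{R}^n$: convex, positively one-homogeneous, positive on $\mathbb{S}^{n-1}$ (not necessarily symmetric). $a(\xi)=H(\xi)^{p-1}\nabla H(\xi)$. A weak solution of the equation is $u\in W^{1,p}_{loc}(\Omega)$ with $f(u)\in L^1_{loc}(\Omega)$ satisfying $\int_\Omega a(\nabla u)\cdot\nabla\phi\,dx=\int_\Omega f(u)\phi\,dx$ for test functions $\phi$; the boundary condition $|\nabla u|=0$ on $\partial\Omega$ is understood in the sense that $\nabla u$ (which extends continuously) vanishes on $\partial\Omega$, so in particular $a(\nabla u)\cdot\nu=0$ on $\partial\Omega$. *)

theory Defs
  imports "HOL-Analysis.Analysis"
begin

definition grad :: "(real^'n \<Rightarrow> real) \<Rightarrow> real^'n \<Rightarrow> real^'n" where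
  "grad g x = (\<chi> i. frechet_derivative g (at x) (axis i 1))"

definition hess :: "(real^'n \<Rightarrow> real) \<Rightarrow> real^'n \<Rightarrow> real^'n \<Rightarrow> real^'n" where
  "hess g x = frechet_derivative (grad g) (at x)"

text \<open>A gauge ("norm" in the paper): convex, positively one-homogeneous, positive on the unit sphere.\<close>
definition gauge_norm :: "(real^'n \<Rightarrow> real) \<Rightarrow> bool" where
  "gauge_norm H \<longleftrightarrow> convex_on UNIV H \<and>
     (\<forall>x. \<forall>t\<ge>0. H (t *\<^sub>R x) = t * H x) \<and>
     (\<forall>x. norm x = 1 \<longrightarrow> H x > 0)"

definition C2_on :: "(real^'n) set \<Rightarrow> (real^'n \<Rightarrow> real) \<Rightarrow> bool" where
  "C2_on S g \<longleftrightarrow> (\<forall>x\<in>S. g differentiable (at x)) \<and>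
     (\<forall>x\<in>S. grad g differentiable (at x)) \<and>
     (\<forall>v. continuous_on S (\<lambda>x. hess g x v))"

definition C11_UNIV :: "(real^'n \<Rightarrow> real) \<Rightarrow> bool" where
  "C11_UNIV g \<longleftrightarrow> (\<forall>x. g differentiable (at x)) \<and>
     (\<forall>K. compact K \<longrightarrow> (\<exists>L. L-lipschitz_on K (grad g)))"

definition afield :: "(real^'n \<Rightarrow> real) \<Rightarrow> real \<Rightarrow> real^'n \<Rightarrow> real^'n" where
  "afield H p \<xi> = (if \<xi> = 0 then 0 else (H \<xi> powr (p - 1)) *\<^sub>R grad H \<xi>)"

definition test_fun :: "(real^'n) set \<Rightarrow> (real^'n \<Rightarrow> real) \<Rightarrow> bool" where
  "test_fun \<Omega> \<phi> \<longleftrightarrow> (\<forall>x. \<phi> differentiable (at x)) \<and> continuous_on UNIV (grad \<phi>) \<and>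
     compact (closure {x. \<phi> x \<noteq> 0}) \<and> closure {x. \<phi> x \<noteq> 0} \<subseteq> \<Omega>"

definition weak_gradient :: "(real^'n) set \<Rightarrow> (real^'n \<Rightarrow> real) \<Rightarrow> (real^'n \<Rightarrow> real^'n) \<Rightarrow> bool" where
  "weak_gradient \<Omega> u Du \<longleftrightarrow>
     (\<forall>\<phi>. test_fun \<Omega> \<phi> \<longrightarrow> (\<forall>i.
        integral \<Omega> (\<lambda>x. u x * grad \<phi> x $ i) = - integral \<Omega> (\<lambda>x. Du x $ i * \<phi> x)))"

definition W1p_loc :: "real \<Rightarrow> (real^'n) set \<Rightarrow> (real^'n \<Rightarrow> real) \<Rightarrow> (real^'n \<Rightarrow> real^'n) \<Rightarrow> bool" where
  "W1p_loc p \<Omega> u Du \<longleftrightarrow> u measurable_on \<Omega> \<and> Du measurable_on \<Omega> \<and>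
     (\<forall>K. compact K \<and> K \<subseteq> \<Omega> \<longrightarrow>
        (\<lambda>x. \<bar>u x\<bar> powr p) integrable_on K \<and> (\<lambda>x. norm (Du x) powr p) integrable_on K) \<and>
     weak_gradient \<Omega> u Du"

definition weak_solution :: "(real^'n \<Rightarrow> real) \<Rightarrow> real \<Rightarrow> (real \<Rightarrow> real) \<Rightarrow> (real^'n) set
     \<Rightarrow> (real^'n \<Rightarrow> real) \<Rightarrow> (real^'n \<Rightarrow> real^'n) \<Rightarrow> bool" where
  "weak_solution H p f \<Omega> u Du \<longleftrightarrow> W1p_loc p \<Omega> u Du \<and>
     (\<forall>K. compact K \<and> K \<subseteq> \<Omega> \<longrightarrow> (\<lambda>x. f (u x)) absolutely_integrable_on K) \<and>
     (\<forall>\<phi>. test_fun \<Omega> \<phi> \<longrightarrow>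
        integral \<Omega> (\<lambda>x. afield H p (Du x) \<bullet> grad \<phi> x) = integral \<Omega> (\<lambda>x. f (u x) * \<phi> x))"

definition neumann_bc :: "(real^'n) set \<Rightarrow> (real^'n \<Rightarrow> real^'n) \<Rightarrow> bool" where
  "neumann_bc \<Omega> Du \<longleftrightarrow> continuous_on (closure \<Omega>) Du \<and> (\<forall>x\<in>frontier \<Omega>. Du x = 0)"

end

theory Submission
  imports Defs
begin

text \<open>
  Since \<open>t \<mapsto> f t / t powr (pstar - 1)\<close> is nonincreasing, \<open>f\<close> changes sign at most once on \<open>(0, \<infinity>)\<close>, from
  plus to minus, at some \<open>t0\<close>; hence \<open>f u * (u - t0) \<le> 0\<close>. As the flux \<open>a(Du)\<close> vanishes on the boundary,
  one may test the equation with 1 and with \<open>u\<close>, which gives \<open>\<integral> f u = 0\<close> and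
  \<open>\<integral> H(Du) powr p = \<integral> a(Du) \<bullet> Du = \<integral> f u * u = \<integral> f u * (u - t0) \<le> 0\<close>. So \<open>Du = 0\<close>.

  To use \<open>u\<close> as a test function one needs that a bounded function with continuous weak gradient \<open>Du\<close> agrees
  a.e. with a \<open>C\<^sup>1\<close> function. Averages of \<open>u\<close> over small cubes satisfy
  \<open>\<bar>u\<^sub>h x - u\<^sub>h y - \<zeta> \<bullet> (x - y)\<bar> \<le> \<omega> * norm (x - y)\<close> wherever \<open>norm (Du - \<zeta>) \<le> \<omega>\<close>, and the estimate passes
  to \<open>u\<close> at Lebesgue points.
\<close>

section \<open>Cutoff functions around convex sets\<close>

text \<open>Two obstacles shape the proof. Neither 1 nor \<open>u\<close> has compact support in
  \<Omega>, so both tests are limits of cutoffs, and convexity supplies these: contracting \<Omega>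
  towards an interior point by the factor 1 - e leaves a margin proportional to e around the copy
  and removes a layer of measure O(e). And the weak gradient sees \<open>u\<close> only up to null
  sets, so the test function is built from a representative \<open>w\<close>, while the sign of
  \<open>f\<close> is read off from \<open>u\<close> itself.

  One function serves as mollifying kernel and as domain cutoff: \<open>bump K d\<close> depends
  only on the distance to a convex set \<open>K\<close>, which is a cube in the first role and a
  contracted copy of \<Omega> in the second. The squared distance to a convex set has a quadratic
  Taylor remainder, hence so has \<open>bump\<close>; integrating this remainder against
  \<open>u\<close> differentiates the mollification.

  Comparing with affine functions of arbitrary slope \<zeta> pays twice: \<zeta> = 0 gives the
  Lipschitz bound that extends \<open>u\<close> to the closure, and \<zeta> = \<open>Du x\<close> on
  small balls gives differentiability at \<open>x\<close>.\<close>

lemma has_derivative_quadratic: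
  fixes g :: "'a::real_normed_vector \<Rightarrow> real"
  assumes L: "bounded_linear L"
    and q: "\<And>s. norm s \<le> 1 \<Longrightarrow> \<bar>g (x + s) - g x - L s\<bar> \<le> C * (norm s)\<^sup>2"
  shows "(g has_derivative L) (at x)"
proof (rule has_derivativeI_sandwich[where e = 1 and H = "\<lambda>y. C * norm (y - x)"])
  fix y assume y: "y \<noteq> x" "dist y x < 1"
  then have "\<bar>g y - g x - L (y - x)\<bar> \<le> C * norm (y - x) * norm (y - x)"
    using q[of "y - x"] by (simp add: dist_norm power2_eq_square mult.assoc)
  then show "norm (g y - g x - L (y - x)) / norm (y - x) \<le> C * norm (y - x)"
    using y by (simp add: pos_divide_le_eq)
next
  show "((\<lambda>y. C * norm (y - x)) \<longlongrightarrow> 0) (at x)"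
    by (rule tendsto_eq_intros refl tendsto_ident_at | simp)+
qed (use L in auto)

text \<open>Each projection is a competitor for the other point. Comparing \<open>z + s\<close> with
  the foot point of \<open>z\<close> gives the upper bound; comparing \<open>z\<close> with the foot
  point of \<open>z + s\<close> gives the lower one, up to the term
  \<open>2 * ((Q - P) \<bullet> s)\<close>, which is at most twice the square of
  \<open>norm s\<close> because the projection is 1-Lipschitz.\<close>

lemma dist_closest_point_sq_taylor:
  fixes K :: "'a::euclidean_space set"
  assumes K: "convex K" "closed K" "K \<noteq> {}"
  shows "\<bar>(dist (z + s) (closest_point K (z + s)))\<^sup>2 - (dist z (closest_point K z))\<^sup>2
            - 2 * ((z - closest_point K z) \<bullet> s)\<bar> \<le> (norm s)\<^sup>2"
proof -
  define P where "P = closest_point K z"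
  define Q where "Q = closest_point K (z + s)"
  have mem: "P \<in> K" "Q \<in> K"
    using closest_point_in_set K by (auto simp: P_def Q_def)
  have sq: "(dist a b)\<^sup>2 = (a - b) \<bullet> (a - b)" for a b :: 'a
    by (simp add: dist_norm power2_norm_eq_inner)
  have "(dist (z + s) Q)\<^sup>2 \<le> (dist (z + s) P)\<^sup>2" "(dist z P)\<^sup>2 \<le> (dist z Q)\<^sup>2"
    using closest_point_le K mem by (auto simp: P_def Q_def intro!: power_mono)
  moreover have "(Q - P) \<bullet> s \<le> (norm s)\<^sup>2"
  proof -
    have "(Q - P) \<bullet> s \<le> norm (Q - P) * norm s" by (rule norm_cauchy_schwarz)
    also have "\<dots> \<le> norm s * norm s"
      using closest_point_lipschitz[OF K, of "z + s" z]
      by (intro mult_right_mono) (auto simp: P_def Q_def dist_norm)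
    finally show ?thesis by (simp add: power2_eq_square)
  qed
  ultimately show ?thesis
    unfolding P_def[symmetric] Q_def[symmetric]
    unfolding sq power2_norm_eq_inner
    by (simp add: algebra_simps inner_commute abs_le_iff)
qed

text \<open>Equal to 1 on \<open>K\<close> and to 0 beyond distance \<open>d\<close>. Squaring the
  distance makes it differentiable across the boundary of \<open>K\<close>; squaring the positive
  part does the same at distance \<open>d\<close>.\<close>

definition bump :: "'a::euclidean_space set \<Rightarrow> real \<Rightarrow> 'a \<Rightarrow> real" where
  "bump K d z = (max 0 (1 - (dist z (closest_point K z) / d)\<^sup>2))\<^sup>2"

definition bump_grad :: "'a::euclidean_space set \<Rightarrow> real \<Rightarrow> 'a \<Rightarrow> 'a" where
  "bump_grad K d z = (- 4 / d\<^sup>2 * max 0 (1 - (dist z (closest_point K z) / d)\<^sup>2)) *\<^sub>R (z - closest_point K z)"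

context
  fixes K :: "'a::euclidean_space set" and d :: real
  assumes K: "convex K" "closed K" "K \<noteq> {}" and d: "0 < d"
begin

text \<open>The constant depends on \<open>z\<close> only through the bound \<open>D\<close>, so the
  remainder can be integrated over a bounded set of \<open>z\<close>. Its first summand is the
  remainder of the squared distance times the outer slope, at most \<open>2 / d\<^sup>2\<close>; the
  second is the remainder of the squared positive part, with increments of the squared distance
  bounded by \<open>(2 * D + 1) * norm s\<close>.\<close>

lemma bump_taylor:
  assumes D: "dist z (closest_point K z) \<le> D" and s: "norm s \<le> 1"
  shows "\<bar>bump K d (z + s) - bump K d z - bump_grad K d z \<bullet> s\<bar>
           \<le> (2 / d\<^sup>2 + ((2 * D + 1) / d\<^sup>2)\<^sup>2) * (norm s)\<^sup>2"
proof -
  define q where "q y = (dist y (closest_point K y))\<^sup>2" for y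
  define w where "w = z - closest_point K z"
  define m where "m = max 0 (1 - q z / d\<^sup>2)"
  define e where "e = q (z + s) - q z"
  have nw: "norm w \<le> D" using D by (simp add: w_def dist_norm)
  have e: "\<bar>e - 2 * (w \<bullet> s)\<bar> \<le> (norm s)\<^sup>2"
    using dist_closest_point_sq_taylor[OF K] by (simp add: e_def q_def w_def)
  have D0: "0 \<le> D" using nw norm_ge_zero order_trans by blast
  have "\<bar>w \<bullet> s\<bar> \<le> D * norm s"
    using Cauchy_Schwarz_ineq2[of w s] nw by (meson mult_right_mono norm_ge_zero order_trans)
  moreover have "(norm s)\<^sup>2 \<le> norm s"
    using s by (simp add: power2_eq_square mult_left_le)
  ultimately have "\<bar>e\<bar> \<le> (2 * D + 1) * norm s"
    using e by (simp add: distrib_right)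
  then have e2: "e\<^sup>2 \<le> ((2 * D + 1) * norm s)\<^sup>2"
    by (metis abs_ge_zero power2_abs power_mono)
  have m: "0 \<le> m" "m \<le> 1" using d by (auto simp: m_def q_def)
  \<comment> \<open>The squared positive part has derivative \<open>2 * max 0 a\<close> and a
    quadratic remainder with constant 1; only the two cases of opposite signs need work.\<close>
  have max_sq: "\<bar>(max 0 b)\<^sup>2 - (max 0 a)\<^sup>2 - 2 * max 0 a * (b - a)\<bar> \<le> (b - a)\<^sup>2" for a b :: real
  proof -
    have 1: "b\<^sup>2 - a\<^sup>2 - 2 * a * (b - a) = (b - a)\<^sup>2" by (simp add: power2_eq_square algebra_simps)
    have 2: "(b - a)\<^sup>2 = b\<^sup>2 + (a\<^sup>2 - 2 * a * b)" by (simp add: power2_eq_square algebra_simps)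
    consider "a \<ge> 0" "b \<ge> 0" | "a < 0" "b < 0" | "a \<ge> 0" "b < 0" | "a < 0" "b \<ge> 0" by linarith
    then show ?thesis
    proof cases
      case 3
      have "a * b \<le> 0" "0 \<le> a\<^sup>2" "0 \<le> b\<^sup>2" using 3 by (auto simp: mult_nonneg_nonpos)
      then have "\<bar>a\<^sup>2 - 2 * a * b\<bar> \<le> (b - a)\<^sup>2"
        unfolding 2 by (intro abs_leI) linarith+
      moreover have "(max 0 b)\<^sup>2 - (max 0 a)\<^sup>2 - 2 * max 0 a * (b - a) = a\<^sup>2 - 2 * a * b"
        using 3 by (simp add: power2_eq_square algebra_simps)
      ultimately show ?thesis by metis
    next
      case 4
      have "a * b \<le> 0" "0 \<le> a\<^sup>2" "0 \<le> b\<^sup>2" using 4 by (auto simp: mult_nonpos_nonneg)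
      then have "\<bar>b\<^sup>2\<bar> \<le> (b - a)\<^sup>2"
        unfolding 2 by (intro abs_leI) linarith+
      then show ?thesis using 4 by simp
    qed (use 1 in auto)
  qed
  have B: "bump K d y = (max 0 (1 - q y / d\<^sup>2))\<^sup>2" for y
    by (simp add: bump_def q_def power_divide)
  have G: "bump_grad K d z \<bullet> s = - (4 / d\<^sup>2) * m * (w \<bullet> s)"
    by (simp add: bump_grad_def m_def q_def w_def power_divide)
  have df: "(1 - q (z + s) / d\<^sup>2) - (1 - q z / d\<^sup>2) = - e / d\<^sup>2"
    by (simp add: e_def diff_divide_distrib)
  have 1: "\<bar>bump K d (z + s) - bump K d z - 2 * m * (- e / d\<^sup>2)\<bar> \<le> (- e / d\<^sup>2)\<^sup>2"
    using max_sq[of "1 - q (z + s) / d\<^sup>2" "1 - q z / d\<^sup>2"] unfolding B df m_def[symmetric] .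
  have 2: "(- e / d\<^sup>2)\<^sup>2 \<le> ((2 * D + 1) / d\<^sup>2)\<^sup>2 * (norm s)\<^sup>2"
    using divide_right_mono[OF e2, of "(d\<^sup>2)\<^sup>2"] by (simp add: power_divide power_mult_distrib)
  have "2 * m * (- e / d\<^sup>2) - bump_grad K d z \<bullet> s = - (2 * m / d\<^sup>2) * (e - 2 * (w \<bullet> s))"
    unfolding G using d by (simp add: field_simps)
  then have "\<bar>2 * m * (- e / d\<^sup>2) - bump_grad K d z \<bullet> s\<bar> = (2 * m / d\<^sup>2) * \<bar>e - 2 * (w \<bullet> s)\<bar>"
    using m d by (simp add: abs_mult)
  also have "\<dots> \<le> (2 / d\<^sup>2) * (norm s)\<^sup>2"
    using m d e by (intro mult_mono) (auto simp: divide_right_mono)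
  finally have 3: "\<bar>2 * m * (- e / d\<^sup>2) - bump_grad K d z \<bullet> s\<bar> \<le> (2 / d\<^sup>2) * (norm s)\<^sup>2" .
  have tri: "\<bar>x - y\<bar> \<le> a \<Longrightarrow> a \<le> b \<Longrightarrow> \<bar>y - z\<bar> \<le> c \<Longrightarrow> \<bar>x - z\<bar> \<le> c + b" for x y z a b c :: real
    by linarith
  show ?thesis
    unfolding distrib_right by (rule tri[OF 1 2 3])
qed

lemma has_derivative_bump: "(bump K d has_derivative (\<lambda>s. bump_grad K d z \<bullet> s)) (at z)"
proof (rule has_derivative_quadratic)
  fix s :: 'a assume "norm s \<le> 1"
  then show "\<bar>bump K d (z + s) - bump K d z - bump_grad K d z \<bullet> s\<bar>
      \<le> (2 / d\<^sup>2 + ((2 * dist z (closest_point K z) + 1) / d\<^sup>2)\<^sup>2) * (norm s)\<^sup>2"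
    by (rule bump_taylor[OF order_refl])
qed (rule bounded_linear_inner_right)

lemma continuous_on_bump: "continuous_on S (bump K d)"
  by (intro continuous_at_imp_continuous_on ballI has_derivative_continuous[OF has_derivative_bump])

lemma continuous_on_bump_grad: "continuous_on S (bump_grad K d)"
  unfolding bump_grad_def divide_inverse
  by (intro continuous_on_scaleR continuous_on_mult continuous_on_max continuous_on_diff continuous_on_power
      continuous_on_dist continuous_on_const continuous_on_id continuous_on_closest_point K)

lemma bump_nonneg: "0 \<le> bump K d z" by (simp add: bump_def)

lemma bump_le_1: "bump K d z \<le> 1"
  by (simp add: bump_def power_le_one)

lemma bump_eq_1: "z \<in> K \<Longrightarrow> bump K d z = 1"
  by (simp add: bump_def closest_point_self)

lemma bump_grad_eq_0: "z \<in> K \<Longrightarrow> bump_grad K d z = 0"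
  by (simp add: bump_grad_def closest_point_self)

lemma bump_pos_imp_near: "bump K d z \<noteq> 0 \<Longrightarrow> dist z (closest_point K z) < d"
  using d abs_square_less_1[of "dist z (closest_point K z) / d"]
  by (auto simp: bump_def max_def le_less split: if_splits)

text \<open>With \<open>t\<close> the distance to \<open>K\<close> in units of \<open>d\<close>, the
  norm is \<open>4 / d\<close> times \<open>max 0 (1 - t\<^sup>2) * t\<close>, and the last factor
  is at most 1. The bound is the same for all \<open>K\<close>.\<close>

lemma norm_bump_grad_le: "norm (bump_grad K d z) \<le> 4 / d"
proof -
  define t where "t = dist z (closest_point K z) / d"
  have t0: "0 \<le> t" using d by (simp add: t_def)
  have td: "norm (z - closest_point K z) = t * d"
    using d by (simp add: t_def dist_norm)
  have "max 0 (1 - t\<^sup>2) * t \<le> 1"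
  proof (cases "t \<le> 1")
    case True
    then show ?thesis using t0 by (intro mult_le_one) auto
  next
    case False
    then have "1 - t\<^sup>2 \<le> 0" by simp
    then show ?thesis by (simp add: max_def)
  qed
  then have "4 / d * (max 0 (1 - t\<^sup>2) * t) \<le> 4 / d * 1"
    using d by (intro mult_left_mono) auto
  moreover have "norm (bump_grad K d z) = 4 / d * (max 0 (1 - t\<^sup>2) * t)"
    unfolding bump_grad_def norm_scaleR td t_def[symmetric] using d
    by (simp add: abs_mult power2_eq_square)
  ultimately show ?thesis by simp
qed

lemma closure_support_bump:
  assumes "z \<in> closure {z. bump K d (z - a) \<noteq> 0}"
  shows "\<exists>x\<in>K. dist z (a + x) \<le> d"
proof -
  have "continuous_on UNIV (\<lambda>z. closest_point K (z - a))"
    by (rule continuous_on_compose2[OF continuous_on_closest_point[OF K, of UNIV]])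
       (auto intro!: continuous_intros)
  then have "closed {z. dist (z - a) (closest_point K (z - a)) \<le> d}"
    by (intro closed_Collect_le continuous_intros)
  moreover have "{z. bump K d (z - a) \<noteq> 0} \<subseteq> {z. dist (z - a) (closest_point K (z - a)) \<le> d}"
    using bump_pos_imp_near by fastforce
  ultimately have "z \<in> {z. dist (z - a) (closest_point K (z - a)) \<le> d}"
    using assms closure_minimal by blast
  then show ?thesis
    using closest_point_in_set K
    by (intro bexI[of _ "closest_point K (z - a)"]) (auto simp: dist_norm algebra_simps)
qed

end

lemma bump_tendsto_indicator:
  assumes K: "convex K" "closed K" "K \<noteq> {}"
    and d: "\<And>k. 0 < d k" "d \<longlonglongrightarrow> 0"
  shows "(\<lambda>k. bump K (d k) z) \<longlonglongrightarrow> indicator K z"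
proof (cases "z \<in> K")
  case True
  then show ?thesis using bump_eq_1[OF K d(1)] by simp
next
  case False
  then have "0 < dist z (closest_point K z)"
    using closest_point_in_set K by (metis zero_less_dist_iff)
  then have "\<forall>\<^sub>F k in sequentially. d k < dist z (closest_point K z)"
    using d(2) by (simp add: order_tendsto_iff)
  then have "\<forall>\<^sub>F k in sequentially. bump K (d k) z = 0"
    by eventually_elim (use bump_pos_imp_near[OF K d(1)] in \<open>fastforce\<close>)
  then show ?thesis using False by (simp add: tendsto_eventually)
qed

section \<open>Gradients, integrability of bounded functions, and cutoffs as test functions\<close>

lemma grad_eq:
  assumes "(g has_derivative (\<lambda>s. G \<bullet> s)) (at x)"
  shows "grad g x = G"
proof -
  have "frechet_derivative g (at x) = (\<lambda>s. G \<bullet> s)"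
    using frechet_derivative_at[OF assms] by simp
  then show ?thesis by (simp add: grad_def vec_eq_iff inner_axis)
qed

lemma has_derivative_grad:
  assumes "g differentiable (at x)"
  shows "(g has_derivative (\<lambda>s. grad g x \<bullet> s)) (at x)"
proof -
  obtain L where L: "(g has_derivative L) (at x)"
    using assms by (auto simp: differentiable_def)
  then have "linear L" using has_derivative_linear by blast
  then have "L s = adjoint L 1 \<bullet> s" for s
    using adjoint_works[of L s 1] by (simp add: inner_commute)
  then have "L = (\<lambda>s. adjoint L 1 \<bullet> s)" by blast
  then show ?thesis using L grad_eq by metis
qed

lemma bounded_measurable_imp_absolutely_integrable:
  fixes f :: "'a::euclidean_space \<Rightarrow> 'b::euclidean_space"
  assumes "S \<in> lmeasurable" "f \<in> borel_measurable (lebesgue_on S)" "\<And>x. x \<in> S \<Longrightarrow> norm (f x) \<le> B"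
  shows "f absolutely_integrable_on S"
  using measurable_bounded_by_integrable_imp_absolutely_integrable[of f S "\<lambda>_. B"] assms
    integrable_on_const fmeasurableD by blast

lemma bounded_continuous_imp_absolutely_integrable:
  fixes f :: "'a::euclidean_space \<Rightarrow> 'b::euclidean_space"
  assumes "S \<in> lmeasurable" "continuous_on S f" "\<And>x. x \<in> S \<Longrightarrow> norm (f x) \<le> B"
  shows "f absolutely_integrable_on S"
  using bounded_measurable_imp_absolutely_integrable assms
    continuous_imp_measurable_on_sets_lebesgue fmeasurableD by blast

lemma integral_translate_compact_support:
  fixes f :: "'a::euclidean_space \<Rightarrow> real"
  assumes f: "continuous_on UNIV f" and bnd: "bounded {z. f z \<noteq> 0}"
    and sub: "\<And>z. f (z - x) \<noteq> 0 \<Longrightarrow> z \<in> S"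
  shows "integral S (\<lambda>z. f (z - x)) = integral UNIV f"
proof -
  obtain a b where ab: "{z. f z \<noteq> 0} \<subseteq> cbox a b"
    using bnd bounded_subset_cbox_symmetric by metis
  have fi: "(f has_integral integral (cbox a b) f) (cbox a b)"
    using integrable_continuous continuous_on_subset[OF f] by (metis integrable_integral subset_UNIV)
  have 1: "(f has_integral integral (cbox a b) f) UNIV"
    by (rule has_integral_on_superset[OF fi]) (use ab in auto)
  have "((\<lambda>z. f (z - x)) has_integral integral (cbox a b) f) (cbox (a + x) (b + x))"
    using has_integral_affinity'[OF fi, of 1 "- x"] by simp
  then have 2: "((\<lambda>z. f (z - x)) has_integral integral (cbox a b) f) UNIV"
  proof (rule has_integral_on_superset)
    fix z assume z: "z \<notin> cbox (a + x) (b + x)"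
    have "z - x \<notin> cbox a b"
      using z by (auto simp: mem_box algebra_simps)
    then show "f (z - x) = 0" using ab by auto
  qed auto
  have "integral S (\<lambda>z. f (z - x)) = integral UNIV (\<lambda>z. f (z - x))"
    unfolding integral_restrict_UNIV[of S, symmetric]
    by (rule integral_cong) (use sub in auto)
  then show ?thesis using 1 2 by (simp add: integral_unique)
qed

text \<open>Test functions are only asked to be \<open>C^1\<close>, so \<open>bump\<close>
  qualifies. The shift \<open>a\<close> is the moving centre of the mollification; the domain
  cutoffs take \<open>a = 0\<close>.\<close>

lemma test_fun_bump:
  fixes K :: "(real^'n) set"
  assumes K: "convex K" "compact K" "K \<noteq> {}" and d: "0 < d"
    and sub: "\<And>k. k \<in> K \<Longrightarrow> cball (a + k) d \<subseteq> \<Omega>"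
  shows "test_fun \<Omega> (\<lambda>z. bump K d (z - a))"
    and "grad (\<lambda>z. bump K d (z - a)) z = bump_grad K d (z - a)"
proof -
  note K' = K(1) compact_imp_closed[OF K(2)] K(3)
  have der: "((\<lambda>z. bump K d (z - a)) has_derivative (\<lambda>s. bump_grad K d (z - a) \<bullet> s)) (at z)" for z
  proof -
    have "((\<lambda>z. z - a) has_derivative (\<lambda>s. s)) (at z)"
      by (auto intro!: derivative_eq_intros)
    from diff_chain_at[OF this has_derivative_bump[OF K' d]]
    show ?thesis by (simp add: o_def)
  qed
  show g: "grad (\<lambda>z. bump K d (z - a)) z = bump_grad K d (z - a)" for z
    by (rule grad_eq[OF der])
  have "continuous_on UNIV (\<lambda>z. bump_grad K d (z - a))"
    using continuous_on_compose[OF _ continuous_on_bump_grad[OF K' d], of UNIV "\<lambda>z. z - a"]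
    by (simp add: o_def continuous_on_diff)
  moreover have "closure {z. bump K d (z - a) \<noteq> 0} \<subseteq> \<Omega>"
    using closure_support_bump[OF K' d, of _ a] sub by (fastforce simp: dist_commute)
  moreover have "compact (closure {z. bump K d (z - a) \<noteq> 0})"
  proof -
    obtain R where R: "\<And>k. k \<in> K \<Longrightarrow> norm k \<le> R"
      using compact_imp_bounded[OF K(2)] bounded_iff by blast
    have "norm z \<le> d + (norm a + R)" if z: "z \<in> closure {z. bump K d (z - a) \<noteq> 0}" for z
    proof -
      obtain k where "k \<in> K" "dist z (a + k) \<le> d"
        using closure_support_bump[OF K' d z] by blast
      then show ?thesis
        using R[of k] norm_triangle_ineq[of a k] norm_triangle_ineq[of "z - (a + k)" "a + k"]
        by (simp add: dist_norm)
    qed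
    then show ?thesis by (metis bounded_iff closed_closure compact_eq_bounded_closed)
  qed
  ultimately show "test_fun \<Omega> (\<lambda>z. bump K d (z - a))"
    unfolding test_fun_def using der g by (auto simp: differentiable_def)
qed

section \<open>Functions with continuous weak gradient\<close>

lemma zero_in_cube: "0 < h \<Longrightarrow> (0::real^'n) \<in> cbox 0 (h *\<^sub>R One)"
  by (simp add: mem_box)

lemma mem_translated_cube_iff: "z - x \<in> cbox 0 (h *\<^sub>R One) \<longleftrightarrow> z \<in> cbox x (x + h *\<^sub>R (One::'a::euclidean_space))"
  by (auto simp: mem_box algebra_simps)

lemma integral_const_lmeasurable:
  fixes c :: real
  assumes "S \<in> lmeasurable"
  shows "integral S (\<lambda>x. c) = c * measure lebesgue S"
  using integral_mult_right[of S c "\<lambda>x. 1"] lmeasure_integral[OF assms] by simp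

text \<open>The bounds \<open>M\<close> and \<open>C\<close> on the bounded set \<Omega> make all
  products with continuous functions integrable. This has to be secured each time an integral is
  split, since \<open>integral\<close> is 0 on non-integrable functions.\<close>

locale bounded_weak_gradient =
  fixes \<Omega> :: "(real^'n) set" and u :: "real^'n \<Rightarrow> real" and Du :: "real^'n \<Rightarrow> real^'n" and M C :: real
  assumes op: "open \<Omega>" and bnd: "bounded \<Omega>"
    and um: "u \<in> borel_measurable (lebesgue_on \<Omega>)" and uM: "\<And>x. x \<in> \<Omega> \<Longrightarrow> \<bar>u x\<bar> \<le> M"
    and Dc: "continuous_on \<Omega> Du" and DC: "\<And>x. x \<in> \<Omega> \<Longrightarrow> norm (Du x) \<le> C"
    and wg: "weak_gradient \<Omega> u Du"
begin

lemma lmeasurable_domain: "\<Omega> \<in> lmeasurable"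
  using op bnd lmeasurable_open by blast

lemma bounded_on_domain:
  fixes g :: "real^'n \<Rightarrow> 'b::real_normed_vector"
  assumes "continuous_on UNIV g"
  obtains B where "0 \<le> B" "\<And>z. z \<in> \<Omega> \<Longrightarrow> norm (g z) \<le> B"
proof -
  have "compact (g ` closure \<Omega>)"
    using assms bnd by (meson compact_closure compact_continuous_image continuous_on_subset subset_UNIV)
  then have "bounded (g ` closure \<Omega>)" by (rule compact_imp_bounded)
  then obtain B where "0 < B" "\<forall>x\<in>closure \<Omega>. norm (g x) \<le> B"
    unfolding bounded_pos by auto
  then show ?thesis
    using that[of B] closure_subset by (meson less_imp_le subsetD)
qed

lemma u_times_integrable:
  assumes g: "continuous_on UNIV g"
  shows "(\<lambda>z. u z * g z) absolutely_integrable_on \<Omega>"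
proof -
  obtain B where B: "0 \<le> B" "\<And>z. z \<in> \<Omega> \<Longrightarrow> norm (g z) \<le> B"
    using bounded_on_domain[OF g] by blast
  have "g \<in> borel_measurable (lebesgue_on \<Omega>)"
    using g lmeasurable_domain continuous_imp_measurable_on_sets_lebesgue continuous_on_subset fmeasurableD subset_UNIV by metis
  then show ?thesis
    using B uM by (intro bounded_measurable_imp_absolutely_integrable[OF lmeasurable_domain, of _ "M * B"] borel_measurable_times um)
      (auto simp: abs_mult intro!: mult_mono order_trans[OF abs_ge_zero])
qed

lemma Du_times_integrable:
  fixes g :: "real^'n \<Rightarrow> real"
  assumes g: "continuous_on UNIV g"
  shows "(\<lambda>z. g z *\<^sub>R Du z) absolutely_integrable_on \<Omega>"
proof -
  obtain B where B: "0 \<le> B" "\<And>z. z \<in> \<Omega> \<Longrightarrow> norm (g z) \<le> B"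
    using bounded_on_domain[OF g] by blast
  show ?thesis
    using B DC Dc continuous_on_subset[OF g]
    by (intro bounded_continuous_imp_absolutely_integrable[OF lmeasurable_domain, of _ "B * C"] continuous_on_scaleR)
      (auto intro!: mult_mono)
qed

lemma weak_gradient_inner:
  assumes t: "test_fun \<Omega> \<phi>"
  shows "integral \<Omega> (\<lambda>z. u z * (grad \<phi> z \<bullet> s)) = - (integral \<Omega> (\<lambda>z. \<phi> z *\<^sub>R Du z) \<bullet> s)"
proof -
  have cg: "continuous_on UNIV (\<lambda>z. grad \<phi> z $ i)" for i
    using t continuous_on_component by (auto simp: test_fun_def)
  have cp: "continuous_on UNIV \<phi>"
    using t by (auto simp: test_fun_def continuous_at_imp_continuous_on differentiable_imp_continuous_within)
  have D: "(\<lambda>z. \<phi> z *\<^sub>R Du z) integrable_on \<Omega>"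
    using Du_times_integrable[OF cp] set_lebesgue_integral_eq_integral(1) by blast
  have i: "(\<lambda>z. u z * grad \<phi> z $ i) integrable_on \<Omega>" for i
    using u_times_integrable[OF cg] set_lebesgue_integral_eq_integral(1) by blast
  have "integral \<Omega> (\<lambda>z. u z * (grad \<phi> z \<bullet> s)) = integral \<Omega> (\<lambda>z. \<Sum>i\<in>UNIV. (u z * grad \<phi> z $ i) * s $ i)"
    by (simp add: inner_vec_def sum_distrib_left mult.assoc)
  also have "\<dots> = (\<Sum>i\<in>UNIV. integral \<Omega> (\<lambda>z. u z * grad \<phi> z $ i) * s $ i)"
    by (subst integral_sum) (auto intro!: integrable_on_mult_left i)
  also have "\<dots> = (\<Sum>i\<in>UNIV. - (integral \<Omega> (\<lambda>z. \<phi> z *\<^sub>R Du z) $ i) * s $ i)"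
  proof (rule sum.cong[OF refl])
    fix i
    have "integral \<Omega> (\<lambda>z. u z * grad \<phi> z $ i) = - integral \<Omega> (\<lambda>z. (\<phi> z *\<^sub>R Du z) $ i)"
      using wg t by (simp add: weak_gradient_def mult.commute)
    then show "integral \<Omega> (\<lambda>z. u z * grad \<phi> z $ i) * s $ i = - (integral \<Omega> (\<lambda>z. \<phi> z *\<^sub>R Du z) $ i) * s $ i"
      unfolding integral_component_eq_cart[OF D] by simp
  qed
  finally show ?thesis by (simp add: inner_vec_def sum_negf)
qed

context
  fixes K :: "(real^'n) set" and d :: real
  assumes K: "convex K" "compact K" "K \<noteq> {}" and d: "0 < d"
begin

lemma continuous_on_shifted_bump: "continuous_on S (\<lambda>z. bump K d (z - a))"
  using continuous_on_compose[OF _ continuous_on_bump[OF K(1) compact_imp_closed[OF K(2)] K(3) d], of S "\<lambda>z. z - a"]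
  by (simp add: o_def continuous_on_diff)

lemma continuous_on_shifted_bump_grad: "continuous_on S (\<lambda>z. bump_grad K d (z - a))"
  using continuous_on_compose[OF _ continuous_on_bump_grad[OF K(1) compact_imp_closed[OF K(2)] K(3) d], of S "\<lambda>z. z - a"]
  by (simp add: o_def continuous_on_diff)

lemma support_shifted_bump:
  assumes "bump K d (z - a) \<noteq> 0"
  shows "\<exists>k\<in>K. dist z (a + k) \<le> d"
proof (rule closure_support_bump[OF K(1) compact_imp_closed[OF K(2)] K(3) d])
  show "z \<in> closure {z. bump K d (z - a) \<noteq> 0}"
    by (rule closure_subset[THEN subsetD]) (use assms in simp)
qed

text \<open>Differentiating in the centre falls on the kernel with a minus sign, and the weak
  gradient identity moves it back to \<open>Du\<close> with another one. The error is the kernel's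
  Taylor remainder integrated against \<open>u\<close>, hence quadratic in \<open>s\<close>.\<close>

lemma has_derivative_mollification:
  assumes sub: "\<And>k. k \<in> K \<Longrightarrow> cball (x + k) d \<subseteq> \<Omega>"
  shows "((\<lambda>x. integral \<Omega> (\<lambda>z. u z * bump K d (z - x))) has_derivative
           (\<lambda>s. integral \<Omega> (\<lambda>z. bump K d (z - x) *\<^sub>R Du z) \<bullet> s)) (at x)"
proof -
  note K' = K(1) compact_imp_closed[OF K(2)] K(3)
  obtain R where R: "\<And>z. z \<in> \<Omega> \<Longrightarrow> norm z \<le> R" using bnd bounded_iff by blast
  obtain k0 where k0: "k0 \<in> K" using K by blast
  \<comment> \<open>\<open>D\<close> bounds the distance of \<open>z - x\<close> from
    \<open>K\<close> for all \<open>z\<close> in \<Omega> at once, which turns \<open>c\<close> into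
    a single Taylor constant for the whole integral.\<close>
  define D where "D = R + norm x + norm k0"
  define c where "c = 2 / d\<^sup>2 + ((2 * D + 1) / d\<^sup>2)\<^sup>2"
  have D: "dist (z - x) (closest_point K (z - x)) \<le> D" if "z \<in> \<Omega>" for z
  proof -
    have "dist (z - x) (closest_point K (z - x)) \<le> dist (z - x) k0"
      using closest_point_le K' k0 by blast
    also have "\<dots> \<le> D"
      using R[OF that] norm_triangle_ineq4[of "z - x" k0] norm_triangle_ineq4[of z x]
      by (simp add: dist_norm D_def)
    finally show ?thesis .
  qed
  note int = set_lebesgue_integral_eq_integral(1)
  have iB: "(\<lambda>z. u z * bump K d (z - a)) integrable_on \<Omega>" for a
    by (rule int[OF u_times_integrable[OF continuous_on_shifted_bump]])
  have iG: "(\<lambda>z. u z * (bump_grad K d (z - x) \<bullet> s)) integrable_on \<Omega>" for s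
    by (rule int[OF u_times_integrable])
       (intro continuous_on_inner continuous_on_shifted_bump_grad continuous_on_const)
  have G: "integral \<Omega> (\<lambda>z. u z * (bump_grad K d (z - x) \<bullet> s))
             = - (integral \<Omega> (\<lambda>z. bump K d (z - x) *\<^sub>R Du z) \<bullet> s)" for s
    using weak_gradient_inner[OF test_fun_bump(1)[OF K d sub]] test_fun_bump(2)[OF K d sub] by simp
  show ?thesis
  proof (rule has_derivative_quadratic[where C = "M * c * measure lebesgue \<Omega>"])
    fix s :: "real^'n" assume s: "norm s \<le> 1"
    \<comment> \<open>Moving the centre by \<open>s\<close> moves the argument of
      \<open>bump\<close> by \<open>- s\<close>, hence the plus sign before the gradient
      term.\<close>
    let ?r = "\<lambda>z. bump K d (z - (x + s)) - bump K d (z - x) + bump_grad K d (z - x) \<bullet> s"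
    have eq: "integral \<Omega> (\<lambda>z. u z * bump K d (z - (x + s))) - integral \<Omega> (\<lambda>z. u z * bump K d (z - x))
          - integral \<Omega> (\<lambda>z. bump K d (z - x) *\<^sub>R Du z) \<bullet> s
        = integral \<Omega> (\<lambda>z. u z * ?r z)"
      using G[of s] integral_add[OF integrable_diff[OF iB[of "x + s"] iB[of x]] iG[of s]]
        integral_diff[OF iB[of "x + s"] iB[of x]]
      by (simp add: algebra_simps)
    have ir: "(\<lambda>z. u z * ?r z) integrable_on \<Omega>"
      using integrable_add[OF integrable_diff[OF iB[of "x + s"] iB[of x]] iG[of s]]
      by (simp add: algebra_simps)
    have "norm (integral \<Omega> (\<lambda>z. u z * ?r z)) \<le> integral \<Omega> (\<lambda>z. M * (c * (norm s)\<^sup>2))"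
    proof (rule integral_norm_bound_integral[OF ir integrable_on_const[OF lmeasurable_domain]])
      fix z assume z: "z \<in> \<Omega>"
      have "\<bar>?r z\<bar> \<le> c * (norm s)\<^sup>2"
        using bump_taylor[OF K' d D[OF z], of "- s"] s by (simp add: c_def algebra_simps)
      then show "norm (u z * ?r z) \<le> M * (c * (norm s)\<^sup>2)"
        unfolding real_norm_def abs_mult using uM[OF z]
        by (intro mult_mono) auto
    qed
    also have "\<dots> = M * c * measure lebesgue \<Omega> * (norm s)\<^sup>2"
      by (simp add: integral_const_lmeasurable[OF lmeasurable_domain])
    finally show "\<bar>integral \<Omega> (\<lambda>z. u z * bump K d (z - (x + s))) - integral \<Omega> (\<lambda>z. u z * bump K d (z - x))
          - integral \<Omega> (\<lambda>z. bump K d (z - x) *\<^sub>R Du z) \<bullet> s\<bar> \<le> M * c * measure lebesgue \<Omega> * (norm s)\<^sup>2"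
      unfolding eq by simp
  qed (rule bounded_linear_inner_right)
qed

lemma integral_shifted_bump:
  assumes sub: "\<And>k. k \<in> K \<Longrightarrow> cball (x + k) d \<subseteq> \<Omega>"
  shows "integral \<Omega> (\<lambda>z. bump K d (z - x)) = integral UNIV (bump K d)"
proof (rule integral_translate_compact_support)
  note K' = K(1) compact_imp_closed[OF K(2)] K(3)
  show "continuous_on UNIV (bump K d)" using continuous_on_bump[OF K' d] .
  obtain R where R: "\<And>k. k \<in> K \<Longrightarrow> norm k \<le> R"
    using compact_imp_bounded[OF K(2)] bounded_iff by blast
  have "norm z \<le> d + R" if nz: "bump K d z \<noteq> 0" for z
  proof -
    obtain k where "k \<in> K" "dist z (0 + k) \<le> d" using support_shifted_bump[of z 0] nz by auto
    then show ?thesis using R[of k] norm_triangle_ineq[of "z - k" k] by (simp add: dist_norm)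
  qed
  then show "bounded {z. bump K d z \<noteq> 0}" unfolding bounded_iff by blast
  show "z \<in> \<Omega>" if "bump K d (z - x) \<noteq> 0" for z
    using support_shifted_bump[OF that] sub by (fastforce simp: dist_commute)
qed

text \<open>After subtracting the affine part, the derivative at \<open>t\<close> is the inner
  product with the kernel average of \<open>Du - \<zeta>\<close>, of norm at most \<omega> times the
  kernel's mass; the mean value inequality on the segment does the rest. The kernel is not
  normalised, so its mass appears on both sides.\<close>

lemma mollification_increment:
  assumes U: "U \<subseteq> \<Omega>" and om: "\<And>z. z \<in> U \<Longrightarrow> norm (Du z - \<zeta>) \<le> \<omega>" "0 \<le> \<omega>"
    and sub: "\<And>t k. t \<in> closed_segment x y \<Longrightarrow> k \<in> K \<Longrightarrow> cball (t + k) d \<subseteq> U"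
  shows "\<bar>integral \<Omega> (\<lambda>z. u z * bump K d (z - x)) - integral \<Omega> (\<lambda>z. u z * bump K d (z - y))
            - integral UNIV (bump K d) * (\<zeta> \<bullet> (x - y))\<bar> \<le> integral UNIV (bump K d) * \<omega> * norm (x - y)"
proof -
  note K' = K(1) compact_imp_closed[OF K(2)] K(3)
  note int = set_lebesgue_integral_eq_integral(1)
  define \<beta> where "\<beta> = integral UNIV (bump K d)"
  define v where "v x = integral \<Omega> (\<lambda>z. u z * bump K d (z - x))" for x
  define A where "A t = integral \<Omega> (\<lambda>z. bump K d (z - t) *\<^sub>R (Du z - \<zeta>))" for t
  have bi: "(\<lambda>z. bump K d (z - a)) integrable_on \<Omega>" for a
    by (rule int[OF bounded_continuous_imp_absolutely_integrable[OF lmeasurable_domain continuous_on_shifted_bump, of _ 1]])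
       (use bump_nonneg[OF K' d] bump_le_1[OF K' d] in auto)
  have Di: "(\<lambda>z. bump K d (z - t) *\<^sub>R Du z) integrable_on \<Omega>" for t
    by (rule int[OF Du_times_integrable[OF continuous_on_shifted_bump]])
  have Zi: "(\<lambda>z. bump K d (z - t) *\<^sub>R \<zeta>) integrable_on \<Omega>" for t
    by (rule integrable_on_scaleR_left[OF bi])
  have "norm ((v x - \<beta> * (\<zeta> \<bullet> x)) - (v y - \<beta> * (\<zeta> \<bullet> y))) \<le> (\<beta> * \<omega>) * norm (x - y)"
  proof (rule differentiable_bound[where S = "closed_segment x y" and f = "\<lambda>t. v t - \<beta> * (\<zeta> \<bullet> t)" and f' = "\<lambda>t s. A t \<bullet> s"])
    fix t assume t: "t \<in> closed_segment x y"
    have st: "cball (t + k) d \<subseteq> \<Omega>" if "k \<in> K" for k using sub[OF t that] U by blast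
    have \<beta>: "integral \<Omega> (\<lambda>z. bump K d (z - t)) = \<beta>"
      unfolding \<beta>_def by (rule integral_shifted_bump[OF st])
    have A: "A t = integral \<Omega> (\<lambda>z. bump K d (z - t) *\<^sub>R Du z) - \<beta> *\<^sub>R \<zeta>"
      unfolding A_def scaleR_diff_right integral_diff[OF Di Zi]
      using integral_linear[OF bi bounded_linear_scaleR_left, of \<zeta> t] \<beta> by (simp add: o_def)
    have "((\<lambda>t. v t - \<beta> * (\<zeta> \<bullet> t)) has_derivative
        (\<lambda>s. integral \<Omega> (\<lambda>z. bump K d (z - t) *\<^sub>R Du z) \<bullet> s - \<beta> * (\<zeta> \<bullet> s))) (at t)"
      unfolding v_def
      by (intro has_derivative_diff has_derivative_mollification[OF st])
         (auto intro!: derivative_eq_intros)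
    then show "((\<lambda>t. v t - \<beta> * (\<zeta> \<bullet> t)) has_derivative (\<lambda>s. A t \<bullet> s)) (at t within closed_segment x y)"
      unfolding A by (simp add: inner_diff_left has_derivative_at_withinI)
    have "norm (A t) \<le> integral \<Omega> (\<lambda>z. bump K d (z - t) * \<omega>)"
      unfolding A_def
    proof (rule integral_norm_bound_integral)
      show "(\<lambda>z. bump K d (z - t) *\<^sub>R (Du z - \<zeta>)) integrable_on \<Omega>"
        unfolding scaleR_diff_right by (rule integrable_diff[OF Di Zi])
      show "(\<lambda>z. bump K d (z - t) * \<omega>) integrable_on \<Omega>"
        by (rule integrable_on_mult_left[OF bi])
      fix z
      show "norm (bump K d (z - t) *\<^sub>R (Du z - \<zeta>)) \<le> bump K d (z - t) * \<omega>"
      proof (cases "bump K d (z - t) = 0")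
        case False
        then obtain k where "k \<in> K" "dist z (t + k) \<le> d"
          using support_shifted_bump[of z t] by blast
        then have "z \<in> U" using sub[OF t, of k] by (auto simp: dist_commute)
        then show ?thesis
          using om bump_nonneg[OF K' d] by (auto simp: mult_left_mono)
      qed simp
    qed
    also have "\<dots> = \<beta> * \<omega>" by (simp add: \<beta>)
    finally have nA: "norm (A t) \<le> \<beta> * \<omega>" .
    show "onorm (\<lambda>s. A t \<bullet> s) \<le> \<beta> * \<omega>"
    proof (rule onorm_le)
      fix s
      have "\<bar>A t \<bullet> s\<bar> \<le> norm (A t) * norm s" by (rule Cauchy_Schwarz_ineq2)
      also have "\<dots> \<le> \<beta> * \<omega> * norm s" using nA by (rule mult_right_mono) simp
      finally show "norm (A t \<bullet> s) \<le> \<beta> * \<omega> * norm s" by simp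
    qed
  qed auto
  moreover have "(v x - \<beta> * (\<zeta> \<bullet> x)) - (v y - \<beta> * (\<zeta> \<bullet> y)) = v x - v y - \<beta> * (\<zeta> \<bullet> (x - y))"
    by (simp add: inner_diff_right algebra_simps)
  ultimately show ?thesis by (simp add: v_def \<beta>_def)
qed

end

end

section \<open>From cube averages to a differentiable representative\<close>

lemma open_subset_closure_Diff_negligible:
  assumes "open U" "negligible N"
  shows "U \<subseteq> closure (U - N)"
proof
  fix x assume x: "x \<in> U"
  show "x \<in> closure (U - N)"
    unfolding closure_iff_nhds_not_empty
  proof (intro allI impI)
    fix A V assume "V \<subseteq> A" "open V" "x \<in> V"
    then have "open (V \<inter> U)" "V \<inter> U \<noteq> {}" using assms x by auto
    then have "\<not> V \<inter> U \<subseteq> N" using assms open_not_negligible negligible_subset by metis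
    then show "(U - N) \<inter> A \<noteq> {}" using \<open>V \<subseteq> A\<close> by blast
  qed
qed

context bounded_weak_gradient
begin

text \<open>As the transition width shrinks to 0, the kernels around the cube converge boundedly to
  its indicator, so the mollified increments become increments of integrals over translated cubes,
  and the mass becomes the volume of the cube.\<close>

lemma box_increment:
  assumes U: "U \<subseteq> \<Omega>" and om: "\<And>z. z \<in> U \<Longrightarrow> norm (Du z - \<zeta>) \<le> \<omega>" "0 \<le> \<omega>"
    and h: "0 < h" and d0: "0 < d0"
    and sub: "\<And>t k. t \<in> closed_segment x y \<Longrightarrow> k \<in> cbox 0 (h *\<^sub>R One) \<Longrightarrow> cball (t + k) d0 \<subseteq> U"
  shows "\<bar>integral (cbox x (x + h *\<^sub>R One)) u - integral (cbox y (y + h *\<^sub>R One)) u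
            - h ^ CARD('n) * (\<zeta> \<bullet> (x - y))\<bar> \<le> h ^ CARD('n) * \<omega> * norm (x - y)"
proof -
  define K where "K = cbox (0::real^'n) (h *\<^sub>R One)"
  have K: "convex K" "compact K" "K \<noteq> {}"
    using zero_in_cube[OF h] by (auto simp: K_def)
  note K' = K(1) compact_imp_closed[OF K(2)] K(3)
  \<comment> \<open>The widths tend to 0 but never exceed \<open>d0\<close>, so the thickened cubes
    stay inside \<open>U\<close> for every index.\<close>
  define d where "d i = d0 / real (Suc i)" for i
  have d: "0 < d i" "d i \<le> d0" for i
    using d0 by (auto simp: d_def divide_le_eq mult_le_cancel_left1)
  have dlim: "d \<longlonglongrightarrow> 0"
    unfolding d_def using LIMSEQ_Suc[OF lim_const_over_n[of d0]] by simp
  have box: "cbox a (a + h *\<^sub>R One) \<subseteq> \<Omega>" if "a \<in> closed_segment x y" for a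
  proof
    fix z assume "z \<in> cbox a (a + h *\<^sub>R One)"
    then have "z - a \<in> cbox 0 (h *\<^sub>R One)" by (simp add: mem_translated_cube_iff)
    from sub[OF that this] have "cball z d0 \<subseteq> U" by simp
    moreover have "z \<in> cball z d0" using d0 by simp
    ultimately show "z \<in> \<Omega>" using U by blast
  qed
  have lim: "(\<lambda>i. integral \<Omega> (\<lambda>z. g z * bump K (d i) (z - a))) \<longlonglongrightarrow> integral (cbox a (a + h *\<^sub>R One)) g"
    if a: "a \<in> closed_segment x y" and g: "g \<in> borel_measurable (lebesgue_on \<Omega>)"
      and gB: "\<And>z. z \<in> \<Omega> \<Longrightarrow> \<bar>g z\<bar> \<le> B" for a B and g :: "real^'n \<Rightarrow> real"
  proof -
    have "(\<lambda>i. integral \<Omega> (\<lambda>z. g z * bump K (d i) (z - a))) \<longlonglongrightarrow> integral \<Omega> (\<lambda>z. g z * indicator K (z - a))"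
    proof (rule dominated_convergence(2)[where h = "\<lambda>_. B"])
      fix i
      have b: "\<bar>g z * bump K (d i) (z - a)\<bar> \<le> B" if "z \<in> \<Omega>" for z
        using mult_mono[OF gB[OF that] bump_le_1[OF K' d(1), of i "z - a"]] bump_nonneg[OF K' d(1), of i "z - a"]
          order_trans[OF abs_ge_zero gB[OF that]] by (simp add: abs_mult)
      then show "norm (g z * bump K (d i) (z - a)) \<le> B" if "z \<in> \<Omega>" for z using that by simp
      have "(\<lambda>z. g z * bump K (d i) (z - a)) \<in> borel_measurable (lebesgue_on \<Omega>)"
        using continuous_imp_measurable_on_sets_lebesgue[OF continuous_on_shifted_bump[OF K d(1)]] lmeasurable_domain
        by (intro borel_measurable_times g) (auto intro: fmeasurableD)
      then show "(\<lambda>z. g z * bump K (d i) (z - a)) integrable_on \<Omega>"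
        by (rule set_lebesgue_integral_eq_integral(1)[OF bounded_measurable_imp_absolutely_integrable[OF lmeasurable_domain, where B = B]])
           (use b in simp)
    qed (auto intro!: integrable_on_const lmeasurable_domain tendsto_mult bump_tendsto_indicator[OF K' d(1) dlim])
    also have "(\<lambda>z. g z * indicator K (z - a)) = (\<lambda>z. if z \<in> cbox a (a + h *\<^sub>R One) then g z else 0)"
      by (auto simp: indicator_def K_def mem_translated_cube_iff)
    also have "integral \<Omega> \<dots> = integral (cbox a (a + h *\<^sub>R One)) g"
      unfolding integral_restrict_Int using box[OF a] by (simp add: Int_absorb2)
    finally show ?thesis .
  qed
  have subK: "cball (t + k) (d i) \<subseteq> U" if "t \<in> closed_segment x y" "k \<in> K" for t k i
    using sub[OF that[unfolded K_def]] d(2)[of i] by (meson order_trans subset_cball)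
  have xs: "x \<in> closed_segment x y" "y \<in> closed_segment x y" by auto
  have "measure lborel (cbox x (x + h *\<^sub>R One)) = h ^ CARD('n)"
    using h by (subst content_cbox) (auto simp: inner_add_left)
  then have c: "integral (cbox x (x + h *\<^sub>R One)) (\<lambda>_. 1) = h ^ CARD('n)"
    by (simp add: integral_const)
  \<comment> \<open>The mass is the same kind of integral with 1 in place of \<open>u\<close>, so
    \<open>lim\<close> identifies its limit too.\<close>
  have "(\<lambda>i. integral UNIV (bump K (d i))) = (\<lambda>i. integral \<Omega> (\<lambda>z. 1 * bump K (d i) (z - x)))"
    using integral_shifted_bump[OF K d(1) order_trans[OF subK[OF xs(1)] U]] by simp
  then have blim: "(\<lambda>i. integral UNIV (bump K (d i))) \<longlonglongrightarrow> h ^ CARD('n)"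
    using lim[OF xs(1), of "\<lambda>_. 1" 1] c by simp
  show ?thesis
  proof (rule LIMSEQ_le)
    show "(\<lambda>i. \<bar>integral \<Omega> (\<lambda>z. u z * bump K (d i) (z - x)) - integral \<Omega> (\<lambda>z. u z * bump K (d i) (z - y))
            - integral UNIV (bump K (d i)) * (\<zeta> \<bullet> (x - y))\<bar>) \<longlonglongrightarrow>
          \<bar>integral (cbox x (x + h *\<^sub>R One)) u - integral (cbox y (y + h *\<^sub>R One)) u - h ^ CARD('n) * (\<zeta> \<bullet> (x - y))\<bar>"
      by (intro tendsto_intros blim lim[OF _ um uM] xs)
    show "(\<lambda>i. integral UNIV (bump K (d i)) * \<omega> * norm (x - y)) \<longlonglongrightarrow> h ^ CARD('n) * \<omega> * norm (x - y)"
      by (intro tendsto_intros blim)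
  qed (use mollification_increment[OF K d(1) U om subK] in blast)
qed

text \<open>Dividing the cube estimate by the volume and letting the side tend to 0 recovers
  \<open>u\<close> at its Lebesgue points. The null set is chosen before \<open>U\<close>, \<zeta>
  and \<omega>: it depends on \<open>u\<close> alone, so it serves all comparison slopes and balls
  at once.\<close>

lemma ae_increment:
  obtains N where "negligible N"
    "\<And>U \<zeta> \<omega> x y. open U \<Longrightarrow> convex U \<Longrightarrow> U \<subseteq> \<Omega> \<Longrightarrow> (\<And>z. z \<in> U \<Longrightarrow> norm (Du z - \<zeta>) \<le> \<omega>) \<Longrightarrow>
       x \<in> U - N \<Longrightarrow> y \<in> U - N \<Longrightarrow> \<bar>u x - u y - \<zeta> \<bullet> (x - y)\<bar> \<le> \<omega> * norm (x - y)"
proof -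
  \<comment> \<open>Extension by 0, so that the function is integrable on every box and cubes need
    not lie in \<Omega> when Lebesgue points are selected.\<close>
  define v where "v z = (if z \<in> \<Omega> then u z else 0)" for z
  have "u absolutely_integrable_on \<Omega>"
    using bounded_measurable_imp_absolutely_integrable[OF lmeasurable_domain um, of M] uM by simp
  then have "u integrable_on \<Omega>" using set_lebesgue_integral_eq_integral(1) by blast
  then have "v integrable_on cbox a b" for a b
    using integrable_altD(1) unfolding v_def by blast
  then obtain N where N: "negligible N"
    and leb: "\<And>x e. \<lbrakk>x \<notin> N; 0 < e\<rbrakk> \<Longrightarrow> \<exists>d>0. \<forall>h. 0 < h \<and> h < d \<longrightarrow>
         norm (integral (cbox x (x + h *\<^sub>R One)) v /\<^sub>R h ^ DIM(real^'n) - v x) < e"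
    using integrable_ccontinuous_explicit[of v] by blast
  have lim: "((\<lambda>h. integral (cbox x (x + h *\<^sub>R One)) v / h ^ CARD('n)) \<longlongrightarrow> v x) (at_right 0)" if "x \<notin> N" for x
  proof (rule tendstoI)
    fix e :: real assume "0 < e"
    from leb[OF that this] obtain d where "d > 0"
      and "\<And>h. 0 < h \<and> h < d \<Longrightarrow> norm (integral (cbox x (x + h *\<^sub>R One)) v /\<^sub>R h ^ DIM(real^'n) - v x) < e"
      by blast
    then show "\<forall>\<^sub>F h in at_right 0. dist (integral (cbox x (x + h *\<^sub>R One)) v / h ^ CARD('n)) (v x) < e"
      unfolding eventually_at_right_field
      by (intro exI[of _ d]) (auto simp: dist_norm divide_inverse mult.commute)
  qed
  show ?thesis
  proof (rule that[OF N])
    fix U \<zeta> \<omega> x y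
    assume U: "open U" "convex U" "U \<subseteq> \<Omega>" and om: "\<And>z. z \<in> U \<Longrightarrow> norm (Du z - \<zeta>) \<le> \<omega>"
      and x: "x \<in> U - N" and y: "y \<in> U - N"
    have om0: "0 \<le> \<omega>" using om[of x] x order_trans[OF norm_ge_zero] by blast
    have seg: "closed_segment x y \<subseteq> U" using x y U closed_segment_subset by blast
    then obtain e where e: "e > 0" "(\<Union>t\<in>closed_segment x y. ball t e) \<subseteq> U"
      using compact_subset_open_imp_ball_epsilon_subset[OF compact_segment U(1) seg] by blast
    \<comment> \<open>A cube of side below \<open>h0\<close> with corner \<open>t\<close> on the
      segment lies within \<open>e / 2\<close> of \<open>t\<close>; thickening by
      \<open>e / 4\<close> still keeps it in the ball of radius \<open>e\<close>. The summand 1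
      makes the inequality strict and the denominator positive.\<close>
    define h0 where "h0 = e / (2 * (1 + norm (One::real^'n)))"
    have h0: "h0 > 0" using e by (auto simp: h0_def add_pos_nonneg)
    have sub: "cball (t + k) (e / 4) \<subseteq> U"
      if t: "t \<in> closed_segment x y" and k: "k \<in> cbox 0 (h *\<^sub>R One)" and h: "0 < h" "h < h0" for t k h
    proof -
      have "norm k \<le> norm (h *\<^sub>R (One::real^'n))"
        by (rule norm_le_componentwise) (use k in \<open>auto simp: mem_box\<close>)
      also have "\<dots> \<le> h * (1 + norm (One::real^'n))" using h by (simp add: mult_left_mono)
      also have "\<dots> < e / 2"
      proof -
        have "0 < 1 + norm (One::real^'n)" by (simp add: add_pos_nonneg)
        then show ?thesis using h(2) unfolding h0_def by (simp add: field_simps)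
      qed
      finally have nk: "norm k < e / 2" .
      have "cball (t + k) (e / 4) \<subseteq> ball t e"
      proof
        fix z assume z: "z \<in> cball (t + k) (e / 4)"
        have "norm (t - z) \<le> norm (t + k - z) + norm k"
          using norm_triangle_ineq4[of "t + k - z" k] by (simp add: algebra_simps)
        then show "z \<in> ball t e" using z nk e(1) by (simp add: dist_norm)
      qed
      then show ?thesis using e(2) t by blast
    qed
    have "\<bar>v x - v y - \<zeta> \<bullet> (x - y)\<bar> \<le> \<omega> * norm (x - y)"
    proof (rule tendsto_upperbound)
      show "((\<lambda>h. \<bar>integral (cbox x (x + h *\<^sub>R One)) v / h ^ CARD('n) - integral (cbox y (y + h *\<^sub>R One)) v / h ^ CARD('n)
                - \<zeta> \<bullet> (x - y)\<bar>) \<longlongrightarrow> \<bar>v x - v y - \<zeta> \<bullet> (x - y)\<bar>) (at_right 0)"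
        using x y by (intro tendsto_intros lim) auto
      show "\<forall>\<^sub>F h in at_right 0. \<bar>integral (cbox x (x + h *\<^sub>R One)) v / h ^ CARD('n)
               - integral (cbox y (y + h *\<^sub>R One)) v / h ^ CARD('n) - \<zeta> \<bullet> (x - y)\<bar> \<le> \<omega> * norm (x - y)"
        unfolding eventually_at_right_field
      proof (intro exI[of _ h0] conjI h0 allI impI)
        fix h assume h: "0 < h" "h < h0"
        have uv: "integral (cbox a (a + h *\<^sub>R One)) v = integral (cbox a (a + h *\<^sub>R One)) u"
          if a: "a \<in> closed_segment x y" for a
        proof (rule integral_cong)
          fix z assume "z \<in> cbox a (a + h *\<^sub>R One)"
          then have "z - a \<in> cbox 0 (h *\<^sub>R One)" by (simp add: mem_translated_cube_iff)
          from sub[OF a this h] have "cball z (e / 4) \<subseteq> U" by simp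
          moreover have "z \<in> cball z (e / 4)" using e(1) by simp
          ultimately have "z \<in> \<Omega>" using U by blast
          then show "v z = u z" by (simp add: v_def)
        qed
        let ?c = "h ^ CARD('n)"
        have c: "?c > 0" using h by simp
        have "\<bar>integral (cbox x (x + h *\<^sub>R One)) v - integral (cbox y (y + h *\<^sub>R One)) v - ?c * (\<zeta> \<bullet> (x - y))\<bar>
                \<le> ?c * \<omega> * norm (x - y)"
          using box_increment[OF U(3) om om0 h(1), of "e / 4" x y] sub h e(1) by (simp add: uv)
        then have "\<bar>integral (cbox x (x + h *\<^sub>R One)) v - integral (cbox y (y + h *\<^sub>R One)) v - ?c * (\<zeta> \<bullet> (x - y))\<bar> / ?c
                \<le> \<omega> * norm (x - y)"
          using c by (simp add: pos_divide_le_eq mult_ac)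
        moreover have "\<bar>a - b - c * r\<bar> / c = \<bar>a / c - b / c - r\<bar>" if "c > 0" for a b c r :: real
        proof -
          have "a - b - c * r = c * (a / c - b / c - r)" using that by (simp add: algebra_simps)
          then show ?thesis using that by (simp add: abs_mult)
        qed
        note this[OF c]
        ultimately show "\<bar>integral (cbox x (x + h *\<^sub>R One)) v / ?c
               - integral (cbox y (y + h *\<^sub>R One)) v / ?c - \<zeta> \<bullet> (x - y)\<bar> \<le> \<omega> * norm (x - y)"
          by simp
      qed
    qed simp
    then show "\<bar>u x - u y - \<zeta> \<bullet> (x - y)\<bar> \<le> \<omega> * norm (x - y)"
      using subsetD[OF U(3), of x] subsetD[OF U(3), of y] x y by (simp add: v_def)
  qed
qed

text \<open>Off the null set \<open>u\<close> is Lipschitz, so it extends to the closure of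
  \<Omega>, which is also the closure of \<Omega> minus that set. By density the increment estimates
  hold for the extension at all points, and with slope \<open>Du x\<close> on a small ball such an
  estimate is the definition of differentiability.\<close>

proposition C1_representative:
  assumes conv: "convex \<Omega>"
  obtains w where "continuous_on (closure \<Omega>) w" "negligible {x \<in> \<Omega>. u x \<noteq> w x}"
    "\<And>x. x \<in> \<Omega> \<Longrightarrow> (w has_derivative (\<lambda>s. Du x \<bullet> s)) (at x)"
proof -
  obtain N where N: "negligible N" and inc: "\<And>U \<zeta> \<omega> x y. open U \<Longrightarrow> convex U \<Longrightarrow> U \<subseteq> \<Omega> \<Longrightarrow>
       (\<And>z. z \<in> U \<Longrightarrow> norm (Du z - \<zeta>) \<le> \<omega>) \<Longrightarrow>
       x \<in> U - N \<Longrightarrow> y \<in> U - N \<Longrightarrow> \<bar>u x - u y - \<zeta> \<bullet> (x - y)\<bar> \<le> \<omega> * norm (x - y)"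
    using ae_increment by blast
  \<comment> \<open>A Lipschitz constant must be nonnegative, and \<open>C\<close> may be negative
    when \<Omega> is empty.\<close>
  have "\<bar>C\<bar>-lipschitz_on (\<Omega> - N) u"
  proof (rule lipschitz_onI)
    fix x y assume "x \<in> \<Omega> - N" "y \<in> \<Omega> - N"
    moreover have "norm (Du z - 0) \<le> \<bar>C\<bar>" if "z \<in> \<Omega>" for z
      using DC[OF that] by simp
    ultimately show "dist (u x) (u y) \<le> \<bar>C\<bar> * dist x y"
      using inc[OF op conv order_refl, of 0 "\<bar>C\<bar>" x y] by (auto simp: dist_norm)
  qed simp
  then obtain w where w: "\<bar>C\<bar>-lipschitz_on (closure (\<Omega> - N)) w" "\<And>x. x \<in> \<Omega> - N \<Longrightarrow> w x = u x"
    using lipschitz_extend_closure by blast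
  have cl: "closure (\<Omega> - N) = closure \<Omega>"
    using open_subset_closure_Diff_negligible[OF op N]
    by (meson Diff_subset closure_minimal closure_mono closed_closure subset_antisym)
  have cw: "continuous_on (closure \<Omega>) w"
    using w(1) lipschitz_on_continuous_on cl by metis
  have inc': "\<bar>w y - w x - \<zeta> \<bullet> (y - x)\<bar> \<le> \<omega> * norm (y - x)"
    if U: "open U" "convex U" "U \<subseteq> \<Omega>" and om: "\<And>z. z \<in> U \<Longrightarrow> norm (Du z - \<zeta>) \<le> \<omega>" and xy: "x \<in> U" "y \<in> U"
    for U \<zeta> \<omega> x y
  proof -
    have "\<exists>X. (\<forall>n. X n \<in> U - N) \<and> X \<longlonglongrightarrow> a" if "a \<in> U" for a
      using open_subset_closure_Diff_negligible[OF U(1) N] that closure_sequential by blast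
    then obtain X Y where X: "\<And>n. X n \<in> U - N" "X \<longlonglongrightarrow> x" and Y: "\<And>n. Y n \<in> U - N" "Y \<longlonglongrightarrow> y"
      using xy by metis
    have lw: "(\<lambda>n. w (Z n)) \<longlonglongrightarrow> w z" if "\<And>n. Z n \<in> U - N" "Z \<longlonglongrightarrow> z" "z \<in> U" for Z z
      by (rule continuous_on_tendsto_compose[OF cw that(2)])
         (use that U(3) closure_subset[of \<Omega>] in \<open>auto intro!: always_eventually\<close>)
    show ?thesis
    proof (rule LIMSEQ_le)
      show "(\<lambda>n. \<bar>w (Y n) - w (X n) - \<zeta> \<bullet> (Y n - X n)\<bar>) \<longlonglongrightarrow> \<bar>w y - w x - \<zeta> \<bullet> (y - x)\<bar>"
        by (intro tendsto_intros lw X Y xy)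
      show "(\<lambda>n. \<omega> * norm (Y n - X n)) \<longlonglongrightarrow> \<omega> * norm (y - x)"
        by (intro tendsto_intros X Y)
      have "\<bar>w (Y n) - w (X n) - \<zeta> \<bullet> (Y n - X n)\<bar> \<le> \<omega> * norm (Y n - X n)" for n
        using inc[OF U om Y(1) X(1), of n n] w(2)[of "X n"] w(2)[of "Y n"] X(1)[of n] Y(1)[of n]
          subsetD[OF U(3), of "X n"] subsetD[OF U(3), of "Y n"] by simp
      then show "\<exists>N. \<forall>n\<ge>N. \<bar>w (Y n) - w (X n) - \<zeta> \<bullet> (Y n - X n)\<bar> \<le> \<omega> * norm (Y n - X n)" by blast
    qed
  qed
  show ?thesis
  proof (rule that[OF cw])
    show "negligible {x \<in> \<Omega>. u x \<noteq> w x}"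
      by (rule negligible_subset[OF N]) (use w(2) in force)
    fix x assume x: "x \<in> \<Omega>"
    show "(w has_derivative (\<lambda>s. Du x \<bullet> s)) (at x)"
      unfolding has_derivative_at_alt
    proof (intro conjI allI impI bounded_linear_inner_right)
      fix e :: real assume e: "0 < e"
      obtain r1 where r1: "r1 > 0" "ball x r1 \<subseteq> \<Omega>" using op x open_contains_ball by blast
      obtain r2 where r2: "r2 > 0" "\<And>z. z \<in> \<Omega> \<Longrightarrow> dist z x < r2 \<Longrightarrow> dist (Du z) (Du x) < e"
        using Dc x e unfolding continuous_on_iff by blast
      define r where "r = min r1 r2"
      have sub: "ball x r \<subseteq> \<Omega>" using r1 by (auto simp: r_def)
      have "norm (Du z - Du x) \<le> e" if "z \<in> ball x r" for z
        using r2(2)[of z] that sub by (auto simp: r_def dist_norm norm_minus_commute)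
      then have "\<bar>w y - w x - Du x \<bullet> (y - x)\<bar> \<le> e * norm (y - x)" if "norm (y - x) < r" for y
        using inc'[OF open_ball convex_ball sub, of "Du x" e x y] that r1 r2
        by (auto simp: r_def dist_norm norm_minus_commute)
      then show "\<exists>d>0. \<forall>y. norm (y - x) < d \<longrightarrow> norm (w y - w x - Du x \<bullet> (y - x)) \<le> e * norm (y - x)"
        using r1 r2 by (intro exI[of _ r]) (auto simp: r_def)
    qed
  qed
qed

end

section \<open>Cutoffs exhausting a convex domain\<close>

definition shrink :: "'a::euclidean_space \<Rightarrow> 'a set \<Rightarrow> real \<Rightarrow> 'a set" where
  "shrink x0 S e = (\<lambda>y. (1 - e) *\<^sub>R y + e *\<^sub>R x0) ` closure S"

context
  fixes \<Omega> :: "(real^'n) set" and x0 :: "real^'n" and r :: real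
  assumes op: "open \<Omega>" and bnd: "bounded \<Omega>" and conv: "convex \<Omega>"
    and r: "0 < r" "cball x0 r \<subseteq> \<Omega>"
begin

lemma shrink_convex: "convex (shrink x0 \<Omega> e)"
  using convex_affinity[OF convex_closure[OF conv], of "e *\<^sub>R x0" "1 - e"]
  by (simp add: shrink_def add.commute)

lemma shrink_compact: "compact (shrink x0 \<Omega> e)"
  using compact_affinity[of "closure \<Omega>" "e *\<^sub>R x0" "1 - e"] bnd
  by (simp add: shrink_def add.commute)

lemma shrink_nonempty: "shrink x0 \<Omega> e \<noteq> {}"
  using r by (auto simp: shrink_def)

text \<open>A point within \<open>e * r\<close> of
  \<open>(1 - e) *\<^sub>R y + e *\<^sub>R x0\<close> arises by replacing \<open>x0\<close> with
  some \<open>c\<close> in the ball of radius \<open>r\<close>. It is thus a convex combination of a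
  closure point and an interior point, and the latter has positive weight.\<close>

lemma shrink_thick_subset:
  assumes e: "0 < e" "e \<le> 1" and k: "k \<in> shrink x0 \<Omega> e"
  shows "cball k (e * r) \<subseteq> \<Omega>"
proof
  fix z assume z: "z \<in> cball k (e * r)"
  obtain y where y: "y \<in> closure \<Omega>" "k = (1 - e) *\<^sub>R y + e *\<^sub>R x0"
    using k by (auto simp: shrink_def)
  define c where "c = x0 + (z - k) /\<^sub>R e"
  have "norm (z - k) / e \<le> r"
    using z e by (simp add: dist_norm norm_minus_commute pos_divide_le_eq mult.commute)
  then have "c \<in> cball x0 r"
    using e by (simp add: c_def dist_norm divide_inverse mult.commute)
  then have "c \<in> interior \<Omega>" using r op by (auto simp: interior_open)
  then have "y - e *\<^sub>R (y - c) \<in> interior \<Omega>"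
    using mem_interior_closure_convex_shrink[OF conv _ y(1)] e by blast
  moreover have "y - e *\<^sub>R (y - c) = z"
    using e by (simp add: c_def y(2) algebra_simps)
  ultimately show "z \<in> \<Omega>" using interior_subset by auto
qed

lemma shrink_subset: "0 < e \<Longrightarrow> e \<le> 1 \<Longrightarrow> shrink x0 \<Omega> e \<subseteq> \<Omega>"
  using shrink_thick_subset r(1) by fastforce

text \<open>The contraction scales volume by \<open>(1 - e) ^ CARD('n)\<close>, and Bernoulli's
  inequality makes the loss linear in \<open>e\<close>.\<close>

lemma measure_Diff_shrink:
  assumes e: "0 < e" "e \<le> 1"
  shows "measure lebesgue (\<Omega> - shrink x0 \<Omega> e) \<le> real CARD('n) * e * measure lebesgue \<Omega>"
proof -
  have lm: "\<Omega> \<in> lmeasurable" "closure \<Omega> \<in> lmeasurable"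
    using op bnd lmeasurable_open lmeasurable_compact compact_closure by blast+
  have "1 + real CARD('n) * (- e) \<le> (1 + (- e)) ^ CARD('n)"
    by (rule Bernoulli_inequality) (use e in simp)
  then have "(1 - real CARD('n) * e) * measure lebesgue \<Omega> \<le> (1 - e) ^ CARD('n) * measure lebesgue (closure \<Omega>)"
    using measure_mono_fmeasurable[OF closure_subset _ lm(2)] lm(1) e
    by (intro order_trans[OF mult_right_mono mult_left_mono]) (auto intro: fmeasurableD)
  also have "\<dots> = measure lebesgue (shrink x0 \<Omega> e)"
    using measure_lebesgue_affine[of "1 - e" "e *\<^sub>R x0" "closure \<Omega>"] e by (simp add: shrink_def)
  finally show ?thesis
    using measurable_measure_Diff[OF lm(1) _ shrink_subset[OF e]] lmeasurable_compact[OF shrink_compact]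
    by (simp add: fmeasurableD algebra_simps)
qed

lemma compact_subset_shrink:
  assumes "compact C" "C \<subseteq> \<Omega>"
  obtains e0 where "0 < e0" "\<And>e. 0 < e \<Longrightarrow> e < e0 \<Longrightarrow> C \<subseteq> shrink x0 \<Omega> e"
proof -
  obtain \<rho> where \<rho>: "\<rho> > 0" "(\<Union>x\<in>C. ball x \<rho>) \<subseteq> \<Omega>"
    using compact_subset_open_imp_ball_epsilon_subset[OF assms(1) op assms(2)] by blast
  obtain R where R: "R > 0" "\<And>z. z \<in> \<Omega> \<Longrightarrow> norm z \<le> R" using bnd bounded_pos by metis
  define e0 where "e0 = min (1 / 2) (\<rho> / (4 * R))"
  have e0: "e0 > 0" using \<rho> R by (simp add: e0_def)
  show thesis
  proof (rule that[OF e0], rule subsetI)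
    fix e z assume e: "0 < e" "e < e0" and z: "z \<in> C"
    have e1: "0 < 1 - e" "1 / (1 - e) \<le> 2" using e by (auto simp: e0_def field_simps)
    \<comment> \<open>The preimage of \<open>z\<close> under the contraction. Its distance to
      \<open>z\<close> is at most \<open>4 * e * R\<close>, because
      \<open>1 / (1 - e) \<le> 2\<close> and \<Omega> lies in the ball of radius \<open>R\<close>;
      this explains both entries of \<open>e0\<close>.\<close>
    define y where "y = z + (e / (1 - e)) *\<^sub>R (z - x0)"
    have "norm (z - x0) \<le> 2 * R"
      using R(2)[of z] R(2)[of x0] z assms(2) r norm_triangle_ineq4[of z x0] by force
    then have "e / (1 - e) * norm (z - x0) \<le> e * 2 * (2 * R)"
      using mult_left_mono[OF e1(2), of e] e R by (intro mult_mono) auto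
    also have "\<dots> < \<rho>" using e(2) R by (simp add: e0_def field_simps)
    finally have "y \<in> ball z \<rho>" using e e1 by (simp add: y_def dist_norm)
    then have "y \<in> closure \<Omega>" using \<rho>(2) z closure_subset by blast
    moreover have "(1 - e) *\<^sub>R y + e *\<^sub>R x0 = z"
    proof -
      have "(1 - e) *\<^sub>R y = (1 - e) *\<^sub>R z + e *\<^sub>R (z - x0)"
        using e1 by (simp add: y_def scaleR_add_right)
      then show ?thesis by (simp add: algebra_simps)
    qed
    ultimately show "z \<in> shrink x0 \<Omega> e" unfolding shrink_def by force
  qed
qed

end

text \<open>The gradient of the cutoff is of size 1/e on a layer of measure O(e), so the boundary term is
  controlled by the maximum of \<open>A\<close> on the layer, which tends to 0 because \<open>A\<close> vanishes on the boundary.\<close>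

lemma cutoff_sequence:
  fixes \<Omega> :: "(real^'n) set" and A :: "real^'n \<Rightarrow> real^'n"
  assumes op: "open \<Omega>" and bnd: "bounded \<Omega>" and conv: "convex \<Omega>" and ne: "\<Omega> \<noteq> {}"
    and A: "continuous_on (closure \<Omega>) A" "\<And>x. x \<in> frontier \<Omega> \<Longrightarrow> A x = 0"
  obtains \<eta> :: "nat \<Rightarrow> real^'n \<Rightarrow> real"
  where "\<And>k. test_fun \<Omega> (\<eta> k)" "\<And>k x. 0 \<le> \<eta> k x" "\<And>k x. \<eta> k x \<le> 1"
    "\<And>x. x \<in> \<Omega> \<Longrightarrow> (\<lambda>k. \<eta> k x) \<longlonglongrightarrow> 1"
    "\<And>w W. continuous_on \<Omega> w \<Longrightarrow> (\<And>x. x \<in> \<Omega> \<Longrightarrow> \<bar>w x\<bar> \<le> W) \<Longrightarrow>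
       (\<lambda>k. integral \<Omega> (\<lambda>x. w x * (A x \<bullet> grad (\<eta> k) x))) \<longlonglongrightarrow> 0"
proof -
  obtain x0 where "x0 \<in> \<Omega>" using ne by blast
  then obtain r where r: "0 < r" "cball x0 r \<subseteq> \<Omega>" using op open_contains_cball by blast
  note loc = op bnd conv r
  have lm: "\<Omega> \<in> lmeasurable" using op bnd lmeasurable_open by blast
  define e where "e k = inverse (real (Suc (Suc k)))" for k
  have e: "0 < e k" "e k \<le> 1" for k by (auto simp: e_def field_simps)
  have elim: "e \<longlonglongrightarrow> 0"
    unfolding e_def using LIMSEQ_Suc[OF LIMSEQ_inverse_real_of_nat] by simp
  define K where "K k = shrink x0 \<Omega> (e k)" for k
  have K: "convex (K k)" "compact (K k)" "K k \<noteq> {}" for k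
    unfolding K_def using shrink_convex[OF loc] shrink_compact[OF loc] shrink_nonempty[OF loc] by auto
  have K': "convex (K k)" "closed (K k)" "K k \<noteq> {}" for k
    using K compact_imp_closed by blast+
  have d: "0 < e k * r" for k using e r by simp
  have sub: "cball (0 + z) (e k * r) \<subseteq> \<Omega>" if "z \<in> K k" for k z
    using shrink_thick_subset[OF loc e] that by (simp add: K_def)
  define \<eta> where "\<eta> k = bump (K k) (e k * r)" for k
  have t: "test_fun \<Omega> (\<eta> k)" and g: "grad (\<eta> k) z = bump_grad (K k) (e k * r) z" for k z
    using test_fun_bump[OF K d sub] by (simp_all add: \<eta>_def)
  have ev: "\<forall>\<^sub>F k in sequentially. C \<subseteq> K k" if C: "compact C" "C \<subseteq> \<Omega>" for C
  proof -
    obtain e0 where "0 < e0" and e0: "\<And>e. 0 < e \<Longrightarrow> e < e0 \<Longrightarrow> C \<subseteq> shrink x0 \<Omega> e"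
      using compact_subset_shrink[OF loc C] by blast
    from order_tendstoD(2)[OF elim \<open>0 < e0\<close>] show ?thesis
      unfolding K_def by eventually_elim (rule e0[OF e(1)])
  qed
  show thesis
  proof (rule that[of \<eta>])
    show "test_fun \<Omega> (\<eta> k)" for k by (rule t)
    show "0 \<le> \<eta> k x" "\<eta> k x \<le> 1" for k x
      unfolding \<eta>_def by (rule bump_nonneg[OF K' d] bump_le_1[OF K' d])+
    show "(\<lambda>k. \<eta> k x) \<longlonglongrightarrow> 1" if "x \<in> \<Omega>" for x
    proof (rule tendsto_eventually)
      show "\<forall>\<^sub>F k in sequentially. \<eta> k x = 1"
        using ev[of "{x}"] that by (auto simp: \<eta>_def bump_eq_1[OF K' d] elim: eventually_mono)
    qed
    fix w :: "real^'n \<Rightarrow> real" and W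
    assume w: "continuous_on \<Omega> w" and W: "\<And>x. x \<in> \<Omega> \<Longrightarrow> \<bar>w x\<bar> \<le> W"
    define W' where "W' = \<bar>W\<bar> + 1"
    have W': "W' > 0" "\<And>x. x \<in> \<Omega> \<Longrightarrow> \<bar>w x\<bar> \<le> W'" using W unfolding W'_def by fastforce+
    \<comment> \<open>The factor left in the layer estimate once \<open>e k\<close> has cancelled,
      plus 1, so that \<open>c\<close> is positive and the final bound
      \<open>\<tau> * (c - 1)\<close> is strictly below \<epsilon>.\<close>
    define c where "c = 4 / r * W' * (real CARD('n) * measure lebesgue \<Omega>) + 1"
    have c: "c > 0" using r W' by (auto simp: c_def intro!: add_nonneg_pos)
    show "(\<lambda>k. integral \<Omega> (\<lambda>x. w x * (A x \<bullet> grad (\<eta> k) x))) \<longlonglongrightarrow> 0"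
    proof (rule tendstoI)
      fix \<epsilon> :: real assume \<epsilon>: "0 < \<epsilon>"
      define \<tau> where "\<tau> = \<epsilon> / c"
      have \<tau>: "\<tau> > 0" "\<tau> * c = \<epsilon>" using \<epsilon> c by (auto simp: \<tau>_def)
      \<comment> \<open>The set where \<open>A\<close> is not small. It avoids the frontier, so it
        is a compact subset of \<Omega> and is eventually swallowed by \<open>K k\<close>; outside
        \<open>K k\<close> the field is then smaller than \<tau>.\<close>
      define C where "C = closure \<Omega> \<inter> {x. \<tau> \<le> norm (A x)}"
      have "closed C"
      proof -
        have "closed (closure \<Omega> \<inter> (\<lambda>x. norm (A x)) -` {\<tau>..})"
          by (intro continuous_closed_preimage continuous_on_norm A) auto
        then show ?thesis by (simp add: C_def vimage_def)
      qed
      moreover have "bounded C" using bnd bounded_closure bounded_subset by (auto simp: C_def)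
      ultimately have "compact C" by (simp add: compact_eq_bounded_closed)
      moreover have "C \<subseteq> \<Omega>"
      proof
        fix x assume x: "x \<in> C"
        then have "x \<notin> frontier \<Omega>" using A(2) \<tau> by (auto simp: C_def)
        then show "x \<in> \<Omega>" using x op by (simp add: C_def frontier_def interior_open)
      qed
      ultimately have "\<forall>\<^sub>F k in sequentially. C \<subseteq> K k" by (rule ev)
      then show "\<forall>\<^sub>F k in sequentially. dist (integral \<Omega> (\<lambda>x. w x * (A x \<bullet> grad (\<eta> k) x))) 0 < \<epsilon>"
      proof eventually_elim
        case (elim k)
        define b where "b = W' * (\<tau> * (4 / (e k * r)))"
        have b0: "0 \<le> b" using W' \<tau> e r by (auto simp: b_def intro!: mult_nonneg_nonneg less_imp_le)
        let ?L = "\<Omega> - K k"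
        have Lm: "?L \<in> lmeasurable" using lm lmeasurable_compact[OF K(2)] by (rule fmeasurable.Diff)
        have le: "\<bar>w x * (A x \<bullet> grad (\<eta> k) x)\<bar> \<le> (if x \<in> ?L then b else 0)" if x: "x \<in> \<Omega>" for x
        proof (cases "x \<in> K k")
          case True
          then show ?thesis using bump_grad_eq_0[OF K' d] by (simp add: g)
        next
          case False
          then have "x \<notin> C" using elim by blast
          moreover have "x \<in> closure \<Omega>" using x closure_subset[of \<Omega>] by (rule subsetD[rotated])
          ultimately have "norm (A x) \<le> \<tau>" by (simp add: C_def)
          then have "\<bar>A x \<bullet> grad (\<eta> k) x\<bar> \<le> \<tau> * (4 / (e k * r))"
            using mult_mono[OF _ norm_bump_grad_le[OF K' d]] \<tau>(1)
            unfolding g by (intro order_trans[OF Cauchy_Schwarz_ineq2]) simp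
          then have "\<bar>w x\<bar> * \<bar>A x \<bullet> grad (\<eta> k) x\<bar> \<le> b"
            unfolding b_def using W'(2)[OF x] W'(1) by (intro mult_mono) auto
          then show ?thesis using False x by (simp add: abs_mult)
        qed
        have cA: "continuous_on \<Omega> A" using A(1) closure_subset continuous_on_subset by blast
        have "continuous_on \<Omega> (\<lambda>x. w x * (A x \<bullet> grad (\<eta> k) x))"
          unfolding g
          by (intro continuous_on_mult continuous_on_inner w cA continuous_on_bump_grad[OF K' d])
        moreover have "norm (w x * (A x \<bullet> grad (\<eta> k) x)) \<le> b" if "x \<in> \<Omega>" for x
          using le[OF that] b0 by (auto split: if_splits)
        ultimately have int: "(\<lambda>x. w x * (A x \<bullet> grad (\<eta> k) x)) integrable_on \<Omega>"
          using bounded_continuous_imp_absolutely_integrable[OF lm] set_lebesgue_integral_eq_integral(1) by blast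
        have intL: "(\<lambda>x. if x \<in> ?L then b else 0) integrable_on \<Omega>"
          unfolding integrable_restrict_Int using Lm by (intro integrable_on_const) (simp add: Int_absorb2)
        have "norm (integral \<Omega> (\<lambda>x. w x * (A x \<bullet> grad (\<eta> k) x))) \<le> integral \<Omega> (\<lambda>x. if x \<in> ?L then b else 0)"
          by (rule integral_norm_bound_integral[OF int intL]) (use le in simp)
        also have "\<dots> = b * measure lebesgue ?L"
          unfolding integral_restrict_Int using integral_const_lmeasurable[OF Lm] by (simp add: Int_absorb2)
        also have "\<dots> \<le> b * (real CARD('n) * e k * measure lebesgue \<Omega>)"
          using measure_Diff_shrink[OF loc e] b0 by (intro mult_left_mono) (auto simp: K_def)
        \<comment> \<open>Here the gradient bound \<open>4 / (e k * r)\<close> meets the layer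
          measure of order \<open>e k\<close>, and the width cancels.\<close>
        also have "\<dots> = \<tau> * (c - 1)"
          using e(1)[of k] r by (simp add: b_def c_def field_simps)
        also have "\<dots> < \<epsilon>" using \<tau> by (simp add: algebra_simps)
        finally show ?case by simp
      qed
    qed
  qed
qed

text \<open>Nothing is known of \<open>w\<close> outside \<Omega>. The product is glued from two
  open sets covering the space: \<Omega>, where the product rule applies, and the complement of the
  support of \<eta>, where it is identically 0.\<close>

lemma test_fun_times:
  fixes \<eta> w :: "real^'n \<Rightarrow> real"
  assumes op: "open \<Omega>" and t: "test_fun \<Omega> \<eta>" and Dc: "continuous_on \<Omega> Dw"
    and w: "\<And>x. x \<in> \<Omega> \<Longrightarrow> (w has_derivative (\<lambda>s. Dw x \<bullet> s)) (at x)"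
  shows "test_fun \<Omega> (\<lambda>x. \<eta> x * w x)"
    and "\<And>x. x \<in> \<Omega> \<Longrightarrow> grad (\<lambda>x. \<eta> x * w x) x = \<eta> x *\<^sub>R Dw x + w x *\<^sub>R grad \<eta> x"
proof -
  have de: "(\<eta> has_derivative (\<lambda>s. grad \<eta> x \<bullet> s)) (at x)" for x
    using t has_derivative_grad by (auto simp: test_fun_def)
  have d1: "((\<lambda>x. \<eta> x * w x) has_derivative (\<lambda>s. (\<eta> x *\<^sub>R Dw x + w x *\<^sub>R grad \<eta> x) \<bullet> s)) (at x)"
    if "x \<in> \<Omega>" for x
    using has_derivative_mult[OF de[of x] w[OF that]]
    by (simp add: inner_add_left mult.commute)
  show g1: "grad (\<lambda>x. \<eta> x * w x) x = \<eta> x *\<^sub>R Dw x + w x *\<^sub>R grad \<eta> x" if "x \<in> \<Omega>" for x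
    by (rule grad_eq[OF d1[OF that]])
  define V where "V = - closure {x. \<eta> x \<noteq> 0}"
  have V: "open V" "\<Omega> \<union> V = UNIV"
    using t by (auto simp: V_def test_fun_def)
  have V0: "\<eta> x * w x = 0" if "x \<in> V" for x
    using that closure_subset[of "{x. \<eta> x \<noteq> 0}"] by (auto simp: V_def)
  have d2: "((\<lambda>x. \<eta> x * w x) has_derivative (\<lambda>s. 0 \<bullet> s)) (at x)" if "x \<in> V" for x
  proof (rule has_derivative_transform_within_open[OF _ V(1) that])
    show "((\<lambda>_. 0) has_derivative (\<lambda>s. 0 \<bullet> s)) (at x)" by simp
  qed (simp add: V0)
  have g2: "grad (\<lambda>x. \<eta> x * w x) x = 0" if "x \<in> V" for x
    by (rule grad_eq[OF d2[OF that]])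
  have cw: "continuous_on \<Omega> w" "continuous_on \<Omega> \<eta>"
    by (intro continuous_at_imp_continuous_on ballI has_derivative_continuous[OF w] has_derivative_continuous[OF de]; assumption)+
  have cg: "continuous_on \<Omega> (grad \<eta>)"
    using t continuous_on_subset unfolding test_fun_def by blast
  have "continuous_on \<Omega> (\<lambda>x. \<eta> x *\<^sub>R Dw x + w x *\<^sub>R grad \<eta> x)"
    by (intro continuous_on_add continuous_on_scaleR cw Dc cg)
  then have "continuous_on \<Omega> (grad (\<lambda>x. \<eta> x * w x))"
    by (rule continuous_on_eq) (simp add: g1)
  moreover have "continuous_on V (grad (\<lambda>x. \<eta> x * w x))"
    by (rule continuous_on_eq[OF continuous_on_const[of V 0]]) (simp add: g2)
  ultimately have c: "continuous_on UNIV (grad (\<lambda>x. \<eta> x * w x))"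
    using continuous_on_open_Un[OF op V(1)] V(2) by metis
  have sub: "closure {x. \<eta> x * w x \<noteq> 0} \<subseteq> closure {x. \<eta> x \<noteq> 0}"
    by (rule closure_mono) auto
  have tc: "compact (closure {x. \<eta> x \<noteq> 0})" "closure {x. \<eta> x \<noteq> 0} \<subseteq> \<Omega>"
    using t by (simp_all add: test_fun_def)
  have s: "compact (closure {x. \<eta> x * w x \<noteq> 0})" "closure {x. \<eta> x * w x \<noteq> 0} \<subseteq> \<Omega>"
    using compact_Int_closed[OF tc(1) closed_closure[of "{x. \<eta> x * w x \<noteq> 0}"]] sub tc(2)
    by (auto simp: Int_absorb1)
  have "(\<lambda>x. \<eta> x * w x) differentiable (at x)" for x
    using d1 d2 V(2) unfolding differentiable_def by blast
  then show "test_fun \<Omega> (\<lambda>x. \<eta> x * w x)"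
    unfolding test_fun_def using c s by blast
qed

section \<open>Gauges\<close>

context
  fixes H :: "real^'n \<Rightarrow> real" and p :: real
  assumes gauge: "gauge_norm H" and C11: "C11_UNIV (\<lambda>x. (H x)\<^sup>2)" and p1: "1 < p"
begin

lemma gauge_homogeneous: "0 \<le> t \<Longrightarrow> H (t *\<^sub>R x) = t * H x"
  using gauge by (simp add: gauge_norm_def)

lemma gauge_zero: "H 0 = 0"
  using gauge_homogeneous[of 0 0] by simp

lemma gauge_pos:
  assumes "x \<noteq> 0"
  shows "0 < H x"
proof -
  have "norm (x /\<^sub>R norm x) = 1" using assms by simp
  then have "0 < H (x /\<^sub>R norm x)" using gauge unfolding gauge_norm_def by blast
  then have "0 < norm x * H (x /\<^sub>R norm x)" using assms by simp
  then show ?thesis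
    using gauge_homogeneous[of "norm x" "x /\<^sub>R norm x"] assms by simp
qed

lemma gauge_nonneg: "0 \<le> H x"
  using gauge_pos[of x] gauge_zero by (cases "x = 0") auto

lemma square_has_derivative: "((\<lambda>x. (H x)\<^sup>2) has_derivative (\<lambda>s. grad (\<lambda>x. (H x)\<^sup>2) x \<bullet> s)) (at x)"
  using C11 by (intro has_derivative_grad) (simp add: C11_UNIV_def)

lemma continuous_on_gauge: "continuous_on S H"
proof -
  have "continuous_on S (\<lambda>x. sqrt ((H x)\<^sup>2))"
    by (intro continuous_on_real_sqrt continuous_at_imp_continuous_on ballI has_derivative_continuous[OF square_has_derivative])
  then show ?thesis by (simp add: gauge_nonneg)
qed

text \<open>The smoothness assumption concerns the square of \<open>H\<close>; away from 0 the gauge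
  is its positive square root.\<close>

lemma gauge_has_derivative:
  assumes "x \<noteq> 0"
  shows "(H has_derivative (\<lambda>s. (grad (\<lambda>x. (H x)\<^sup>2) x /\<^sub>R (2 * H x)) \<bullet> s)) (at x)"
proof -
  have "DERIV sqrt ((H x)\<^sup>2) :> inverse (sqrt ((H x)\<^sup>2)) / 2"
    using gauge_pos[OF assms] by (intro DERIV_real_sqrt) simp
  from DERIV_compose_FDERIV[OF this square_has_derivative]
  show ?thesis using gauge_nonneg[of x] by (simp add: gauge_nonneg field_simps)
qed

lemma grad_gauge: "x \<noteq> 0 \<Longrightarrow> grad H x = grad (\<lambda>x. (H x)\<^sup>2) x /\<^sub>R (2 * H x)"
  by (rule grad_eq[OF gauge_has_derivative])

text \<open>Differentiate \<open>H (t *\<^sub>R x) = t * H x\<close> at t = 1. Homogeneity is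
  one-sided, so the two functions of t are compared on the positive half-line only.\<close>

lemma euler_identity:
  assumes "x \<noteq> 0"
  shows "grad H x \<bullet> x = H x"
proof -
  have 1: "(H has_derivative (\<lambda>s. grad H x \<bullet> s)) (at (1 *\<^sub>R x))"
    using gauge_has_derivative[OF assms] grad_gauge[OF assms] by simp
  have "((\<lambda>t. t *\<^sub>R x) has_derivative (\<lambda>s. s *\<^sub>R x)) (at (1::real))"
    by (auto intro!: derivative_eq_intros)
  from diff_chain_at[OF this 1]
  have "((\<lambda>t. H (t *\<^sub>R x)) has_derivative (\<lambda>s. s * (grad H x \<bullet> x))) (at (1::real))"
    by (simp add: o_def)
  then have "((\<lambda>t. H (t *\<^sub>R x)) has_real_derivative grad H x \<bullet> x) (at (1::real))"
    by (simp add: has_field_derivative_def mult_commute_abs)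
  moreover have "((\<lambda>t. H (t *\<^sub>R x)) has_real_derivative H x) (at (1::real))"
  proof (rule has_field_derivative_transform_within_open[where S = "{0<..}"])
    show "((\<lambda>t. t * H x) has_real_derivative H x) (at 1)"
      by (auto intro!: derivative_eq_intros)
  qed (auto simp: gauge_homogeneous)
  ultimately show ?thesis by (rule DERIV_unique)
qed

lemma afield_inner_self: "afield H p \<xi> \<bullet> \<xi> = H \<xi> powr p"
  using euler_identity[of \<xi>] powr_mult_base[OF gauge_nonneg, of \<xi> "p - 1"]
  by (simp add: afield_def gauge_zero mult.commute)

lemma continuous_on_grad_square: "continuous_on S (grad (\<lambda>x. (H x)\<^sup>2))"
proof (rule continuous_at_imp_continuous_on, rule ballI)
  fix x :: "real^'n"
  obtain L where "L-lipschitz_on (cball x 1) (grad (\<lambda>x. (H x)\<^sup>2))"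
    using C11 compact_cball unfolding C11_UNIV_def by blast
  then have "continuous_on (cball x 1) (grad (\<lambda>x. (H x)\<^sup>2))" by (rule lipschitz_on_continuous_on)
  then show "continuous (at x) (grad (\<lambda>x. (H x)\<^sup>2))"
    by (rule continuous_on_interior) simp
qed

text \<open>Only the origin is delicate. There the gradient of the square of \<open>H\<close> is
  bounded by \<open>L * norm \<xi>\<close>, while \<open>H \<xi>\<close> is at least
  \<open>m * norm \<xi>\<close>; so \<open>grad H\<close> stays bounded by
  \<open>L / (2 * m)\<close>, and the factor \<open>H \<xi> powr (p - 1)\<close> tends to 0 because
  \<open>p > 1\<close>.\<close>

lemma continuous_on_afield: "continuous_on UNIV (afield H p)"
proof -
  define Q where "Q = grad (\<lambda>x. (H x)\<^sup>2)"
  have A: "afield H p \<xi> = (H \<xi> powr (p - 1) * inverse (2 * H \<xi>)) *\<^sub>R Q \<xi>" if "\<xi> \<noteq> 0" for \<xi>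
    using that by (simp add: afield_def grad_gauge Q_def)
  have off: "continuous_on (- {0}) (afield H p)"
  proof (subst continuous_on_cong[OF refl])
    show "continuous_on (- {0}) (\<lambda>\<xi>. (H \<xi> powr (p - 1) * inverse (2 * H \<xi>)) *\<^sub>R Q \<xi>)"
      unfolding Q_def
      by (intro continuous_on_scaleR continuous_on_mult continuous_on_powr continuous_on_inverse
          continuous_on_gauge continuous_on_grad_square continuous_on_const)
         (use gauge_pos in force)+
  qed (use A in auto)
  have "((afield H p) \<longlongrightarrow> 0) (at 0)"
  proof -
    obtain L where L: "L-lipschitz_on (cball 0 1) Q"
      using C11 compact_cball unfolding C11_UNIV_def Q_def by blast
    \<comment> \<open>The square of \<open>H\<close> has a minimum at 0, so its gradient vanishes
      there and the Lipschitz bound becomes linear growth.\<close>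
    have "(\<lambda>s. Q 0 \<bullet> s) = (\<lambda>s. 0)"
      using differential_zero_maxmin[OF _ open_UNIV square_has_derivative, of 0]
      by (simp add: Q_def gauge_zero)
    then have Q0: "Q 0 = 0" by (metis inner_eq_zero_iff)
    have "\<exists>z\<in>sphere (0::real^'n) 1. \<forall>x\<in>sphere 0 1. H z \<le> H x"
      by (rule continuous_attains_inf[OF compact_sphere _ continuous_on_gauge]) simp
    then obtain z where z: "norm z = 1" "\<And>x. norm x = 1 \<Longrightarrow> H z \<le> H x" by auto
    define m where "m = H z"
    have m: "m > 0" unfolding m_def using z(1) by (intro gauge_pos) auto
    have mH: "m * norm x \<le> H x" if "x \<noteq> 0" for x
    proof -
      have "m \<le> H (x /\<^sub>R norm x)" unfolding m_def by (rule z(2)) (use that in simp)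
      also have "\<dots> = H x / norm x"
        by (subst gauge_homogeneous) (auto simp: divide_inverse mult.commute)
      finally show ?thesis using that by (simp add: pos_le_divide_eq)
    qed
    have L0: "L \<ge> 0" using L lipschitz_on_nonneg by blast
    have le: "norm (afield H p \<xi>) \<le> L / (2 * m) * H \<xi> powr (p - 1)" if \<xi>: "\<xi> \<noteq> 0" "norm \<xi> \<le> 1" for \<xi>
    proof -
      have "norm (Q \<xi>) \<le> L * norm \<xi>"
        using lipschitz_onD[OF L, of \<xi> 0] \<xi> Q0 by simp
      then have "norm (Q \<xi>) * m \<le> (L * norm \<xi>) * m" using m by (intro mult_right_mono) auto
      also have "\<dots> \<le> L * H \<xi>" using mult_left_mono[OF mH[OF \<xi>(1)] L0] by (simp add: mult_ac)
      finally have "norm (Q \<xi>) * m \<le> L * H \<xi>" .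
      then have "inverse (2 * H \<xi>) * norm (Q \<xi>) \<le> L / (2 * m)"
        using gauge_pos[OF \<xi>(1)] m by (simp add: field_simps)
      then have "H \<xi> powr (p - 1) * (inverse (2 * H \<xi>) * norm (Q \<xi>)) \<le> H \<xi> powr (p - 1) * (L / (2 * m))"
        by (rule mult_left_mono) simp
      then show ?thesis using gauge_pos[OF \<xi>(1)] by (simp add: A[OF \<xi>(1)] mult_ac)
    qed
    have "isCont H 0"
      using continuous_on_gauge[of UNIV] by (simp add: continuous_on_eq_continuous_at)
    then have "(H \<longlongrightarrow> 0) (at 0)" by (simp add: isCont_def gauge_zero)
    then have "((\<lambda>\<xi>. H \<xi> powr (p - 1)) \<longlongrightarrow> 0) (at 0)"
      by (rule tendsto_zero_powrI[OF _ tendsto_const]) (use p1 gauge_nonneg in auto)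
    then have "((\<lambda>\<xi>. L / (2 * m) * H \<xi> powr (p - 1)) \<longlongrightarrow> 0) (at 0)"
      by (rule tendsto_mult_right_zero)
    then show ?thesis
    proof (rule Lim_null_comparison[rotated])
      show "\<forall>\<^sub>F \<xi> in at 0. norm (afield H p \<xi>) \<le> L / (2 * m) * H \<xi> powr (p - 1)"
        unfolding eventually_at using le by (intro exI[of _ 1]) (simp add: less_imp_le)
    qed
  qed
  then have "isCont (afield H p) 0" by (simp add: isCont_def afield_def)
  moreover have "isCont (afield H p) \<xi>" if "\<xi> \<noteq> 0" for \<xi>
    using off that by (simp add: continuous_on_eq_continuous_at open_Compl)
  ultimately show ?thesis
    by (intro continuous_at_imp_continuous_on ballI) metis
qed

end

section \<open>Rigidity\<close>

lemma integral_zero_continuous_nonneg: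
  fixes g :: "'a::euclidean_space \<Rightarrow> real"
  assumes op: "open S" and g: "continuous_on S g" "g integrable_on S" "\<And>x. x \<in> S \<Longrightarrow> 0 \<le> g x"
    and le: "integral S g \<le> 0" and x: "x \<in> S"
  shows "g x = 0"
proof -
  obtain a b where ab: "cbox a b \<subseteq> S" "x \<in> box a b"
    using open_contains_cbox[OF op x] by metis
  have int: "g integrable_on cbox a b"
    using g(1) ab continuous_on_subset integrable_continuous by blast
  have "integral (cbox a b) g \<le> 0"
    using integral_subset_le[OF ab(1) int g(2)] g(3) le by auto
  moreover have "0 \<le> integral (cbox a b) g"
    using integral_nonneg[OF int] g(3) ab by blast
  ultimately have "(g has_integral 0) (cbox a b)"
    using int by (metis antisym integrable_integral)
  moreover have "x \<in> cbox a b" using ab(2) box_subset_cbox by blast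
  moreover have "0 \<le> g y" if "y \<in> box a b" for y
    using that ab(1) box_subset_cbox g(3) by blast
  ultimately show ?thesis
    using has_integral_0_cbox_imp_0[of a b g x] ab continuous_on_subset[OF g(1)] by blast
qed

text \<open>The quotient has the sign of \<open>f\<close> and is nonincreasing, so once negative it
  stays negative, and the infimum of the negativity set separates the signs. If that set is empty
  there is no sign change; then \<open>M\<close> serves as threshold, which is why the conclusion is
  limited to \<open>t \<le> M\<close>.\<close>

lemma sign_change_threshold:
  fixes f :: "real \<Rightarrow> real"
  assumes mono: "\<And>s t. 0 < s \<Longrightarrow> s \<le> t \<Longrightarrow> f t / t powr q \<le> f s / s powr q"
  obtains t0 where "\<And>t. 0 < t \<Longrightarrow> t \<le> M \<Longrightarrow> f t * (t - t0) \<le> 0"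
proof (cases "\<exists>s>0. f s < 0")
  case True
  define S where "S = {s. 0 < s \<and> f s < 0}"
  have S: "S \<noteq> {}" "bdd_below S" using True by (auto simp: S_def intro: bdd_belowI[of _ 0])
  show ?thesis
  proof (rule that[of "Inf S"])
    fix t :: real assume t: "0 < t"
    consider "t < Inf S" | "t = Inf S" | "Inf S < t" by linarith
    then show "f t * (t - Inf S) \<le> 0"
    proof cases
      case 1
      then have "t \<notin> S" using cInf_lower[OF _ S(2)] by force
      then show ?thesis using 1 t by (simp add: S_def mult_nonneg_nonpos)
    next
      case 3
      then obtain s where "s \<in> S" "s < t" using cInf_lessD[OF S(1)] by blast
      then have "f t / t powr q \<le> f s / s powr q" "f s / s powr q < 0"
        using mono[of s t] by (auto simp: S_def divide_neg_pos)
      then have "f t / t powr q < 0" by linarith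
      then have "f t < 0" using t by (simp add: divide_less_0_iff)
      then show ?thesis using 3 by (simp add: mult_nonpos_nonneg)
    qed simp
  qed
next
  case False
  then have "0 \<le> f t" if "0 < t" for t using that by (meson not_le)
  then show ?thesis by (intro that[of M] mult_nonneg_nonpos) auto
qed

theorem theorem1p5:
  fixes H :: "real^'n \<Rightarrow> real" and f :: "real \<Rightarrow> real"
    and \<Omega> :: "(real^'n) set" and u :: "real^'n \<Rightarrow> real" and Du :: "real^'n \<Rightarrow> real^'n"
    and p pstar lam Lam :: real
  assumes n2: "CARD('n) \<ge> 2"
    and p: "1 < p" "p < real CARD('n)"
    and pstar: "pstar = real CARD('n) * p / (real CARD('n) - p)"
    and dom: "open \<Omega>" "connected \<Omega>" "\<Omega> \<noteq> {}" "bounded \<Omega>" "convex \<Omega>"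
    and Hnorm: "gauge_norm H"
    and H2C2: "C2_on (UNIV - {0}) (\<lambda>x. (H x)\<^sup>2)"
    and H2C11: "C11_UNIV (\<lambda>x. (H x)\<^sup>2)"
    and ell: "0 < lam" "lam \<le> Lam"
    and ellH: "\<And>x \<xi>. x \<noteq> 0 \<Longrightarrow>
        lam * (norm \<xi>)\<^sup>2 \<le> H x * (\<xi> \<bullet> hess H x \<xi>) + (grad H x \<bullet> \<xi>)\<^sup>2 \<and>
        H x * (\<xi> \<bullet> hess H x \<xi>) + (grad H x \<bullet> \<xi>)\<^sup>2 \<le> Lam * (norm \<xi>)\<^sup>2"
    and fC1: "\<exists>f'. (\<forall>t. (f has_real_derivative f' t) (at t)) \<and> continuous_on UNIV f'"
    and fmono: "\<And>s t. 0 < s \<Longrightarrow> s \<le> t \<Longrightarrow> f t / t powr (pstar - 1) \<le> f s / s powr (pstar - 1)"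
    and sol: "weak_solution H p f \<Omega> u Du"
    and bc: "neumann_bc \<Omega> Du"
    and upos: "\<And>x. x \<in> \<Omega> \<Longrightarrow> u x > 0"
    and ubdd: "\<exists>M. \<forall>x\<in>\<Omega>. \<bar>u x\<bar> \<le> M"
  shows "\<exists>c. negligible {x \<in> \<Omega>. u x \<noteq> c}"
proof -
  note int = set_lebesgue_integral_eq_integral(1)
  define A where "A x = afield H p (Du x)" for x
  have lm: "\<Omega> \<in> lmeasurable" using dom lmeasurable_open by blast
  have cDu: "continuous_on (closure \<Omega>) Du" and Du0: "\<And>x. x \<in> frontier \<Omega> \<Longrightarrow> Du x = 0"
    using bc by (auto simp: neumann_bc_def)
  have cDu': "continuous_on \<Omega> Du" using cDu closure_subset continuous_on_subset by blast
  have cA: "continuous_on (closure \<Omega>) A"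
    unfolding A_def
    using continuous_on_compose[OF cDu continuous_on_subset[OF continuous_on_afield[OF Hnorm H2C11 p(1)]]]
    by (simp add: o_def)
  have cA': "continuous_on \<Omega> A" using cA closure_subset continuous_on_subset by blast
  have A0: "A x = 0" if "x \<in> frontier \<Omega>" for x
    using Du0[OF that] by (simp add: A_def afield_def)
  have bdd: "\<exists>B. \<forall>x\<in>\<Omega>. norm (g x) \<le> B" if "continuous_on (closure \<Omega>) g" for g :: "real^'n \<Rightarrow> 'b::real_normed_vector"
  proof -
    have "bounded (g ` closure \<Omega>)"
      using that dom(4) by (meson compact_closure compact_continuous_image compact_imp_bounded)
    then show ?thesis unfolding bounded_iff using closure_subset by blast
  qed
  obtain CD where CD: "\<And>x. x \<in> \<Omega> \<Longrightarrow> norm (Du x) \<le> CD" using bdd[OF cDu] by blast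
  obtain CA where CA: "\<And>x. x \<in> \<Omega> \<Longrightarrow> norm (A x) \<le> CA" using bdd[OF cA] by blast
  obtain M where M: "\<And>x. x \<in> \<Omega> \<Longrightarrow> \<bar>u x\<bar> \<le> M" using ubdd by blast
  have W: "W1p_loc p \<Omega> u Du"
    and weq: "\<And>\<phi>. test_fun \<Omega> \<phi> \<Longrightarrow> integral \<Omega> (\<lambda>x. A x \<bullet> grad \<phi> x) = integral \<Omega> (\<lambda>x. f (u x) * \<phi> x)"
    using sol by (auto simp: weak_solution_def A_def)
  interpret bounded_weak_gradient \<Omega> u Du M CD
  proof
    show "u \<in> borel_measurable (lebesgue_on \<Omega>)"
      using W lm measurable_on_iff_borel_measurable[of \<Omega> u] by (auto simp: W1p_loc_def fmeasurableD)
    show "weak_gradient \<Omega> u Du" using W by (simp add: W1p_loc_def)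
  qed (use dom cDu' CD M in auto)
  obtain w where cw: "continuous_on (closure \<Omega>) w" and uw: "negligible {x \<in> \<Omega>. u x \<noteq> w x}"
    and dw: "\<And>x. x \<in> \<Omega> \<Longrightarrow> (w has_derivative (\<lambda>s. Du x \<bullet> s)) (at x)"
    using C1_representative[OF dom(5)] by blast
  have cw': "continuous_on \<Omega> w" using cw closure_subset continuous_on_subset by blast
  \<comment> \<open>Holds for arbitrary \<open>F\<close>: altering an integrand on a null set
    changes neither its integrability nor its integral.\<close>
  have ae: "integral \<Omega> (\<lambda>x. F (u x) x) = integral \<Omega> (\<lambda>x. F (w x) x)" for F :: "real \<Rightarrow> real^'n \<Rightarrow> real"
    by (rule integral_spike[OF uw]) auto
  obtain Cw where Cw: "\<And>x. x \<in> \<Omega> \<Longrightarrow> \<bar>w x\<bar> \<le> Cw" using bdd[OF cw] by auto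
  have cf: "continuous_on UNIV f"
    using fC1 DERIV_isCont by (auto intro!: continuous_at_imp_continuous_on)
  have cfw: "continuous_on (closure \<Omega>) (\<lambda>x. f (w x))"
    using continuous_on_compose[OF cw continuous_on_subset[OF cf]] by (simp add: o_def)
  have cfw': "continuous_on \<Omega> (\<lambda>x. f (w x))" using cfw closure_subset continuous_on_subset by blast
  obtain Cf where Cf: "\<And>x. x \<in> \<Omega> \<Longrightarrow> \<bar>f (w x)\<bar> \<le> Cf" using bdd[OF cfw] by auto

  obtain \<eta> where \<eta>: "\<And>k. test_fun \<Omega> (\<eta> k)" "\<And>k x. 0 \<le> \<eta> k x" "\<And>k x. \<eta> k x \<le> 1"
    "\<And>x. x \<in> \<Omega> \<Longrightarrow> (\<lambda>k. \<eta> k x) \<longlonglongrightarrow> 1"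
    and layer: "\<And>w W. continuous_on \<Omega> w \<Longrightarrow> (\<And>x. x \<in> \<Omega> \<Longrightarrow> \<bar>w x\<bar> \<le> W) \<Longrightarrow>
       (\<lambda>k. integral \<Omega> (\<lambda>x. w x * (A x \<bullet> grad (\<eta> k) x))) \<longlonglongrightarrow> 0"
    using cutoff_sequence[OF dom(1,4,5,3) cA A0] by blast
  have c\<eta>: "continuous_on \<Omega> (\<eta> k)" "continuous_on \<Omega> (grad (\<eta> k))" for k
    using \<eta>(1)[of k] unfolding test_fun_def
    by (auto intro: continuous_on_subset continuous_at_imp_continuous_on differentiable_imp_continuous_within)
  have lim: "(\<lambda>k. integral \<Omega> (\<lambda>x. \<eta> k x * g x)) \<longlonglongrightarrow> integral \<Omega> g"
    if g: "continuous_on \<Omega> g" "\<And>x. x \<in> \<Omega> \<Longrightarrow> \<bar>g x\<bar> \<le> B" for g B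
  proof (rule dominated_convergence(2)[where h = "\<lambda>_. B"])
    fix k
    have b: "\<bar>\<eta> k x * g x\<bar> \<le> B" if "x \<in> \<Omega>" for x
      using mult_mono[OF \<eta>(3)[of k x] g(2)[OF that]] \<eta>(2)[of k x] by (simp add: abs_mult)
    then show "norm (\<eta> k x * g x) \<le> B" if "x \<in> \<Omega>" for x using that by simp
    show "(\<lambda>x. \<eta> k x * g x) integrable_on \<Omega>"
      by (rule int[OF bounded_continuous_imp_absolutely_integrable[OF lm, where B = B]])
         (use b in \<open>auto intro!: continuous_on_mult c\<eta> g(1)\<close>)
  next
    show "(\<lambda>k. \<eta> k x * g x) \<longlonglongrightarrow> g x" if "x \<in> \<Omega>" for x
      using tendsto_mult_right[OF \<eta>(4)[OF that], of "g x"] by simp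
  qed (use integrable_on_const[OF lm] in auto)

  \<comment> \<open>The test with 1, as a limit of tests with \<open>\<eta> k\<close>: the flux side
    is exactly the layer term with weight 1.\<close>
  have f_zero: "integral \<Omega> (\<lambda>x. f (w x)) = 0"
  proof (rule LIMSEQ_unique)
    show "(\<lambda>k. integral \<Omega> (\<lambda>x. \<eta> k x * f (w x))) \<longlonglongrightarrow> integral \<Omega> (\<lambda>x. f (w x))"
      by (rule lim[OF cfw' Cf])
    have "integral \<Omega> (\<lambda>x. \<eta> k x * f (w x)) = integral \<Omega> (\<lambda>x. 1 * (A x \<bullet> grad (\<eta> k) x))" for k
      using weq[OF \<eta>(1), of k] ae[of "\<lambda>t x. f t * \<eta> k x"] by (simp add: mult.commute)
    then show "(\<lambda>k. integral \<Omega> (\<lambda>x. \<eta> k x * f (w x))) \<longlonglongrightarrow> 0"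
      using layer[of "\<lambda>_. 1" 1] by simp
  qed

  have cAD: "continuous_on \<Omega> (\<lambda>x. A x \<bullet> Du x)" by (intro continuous_on_inner cA' cDu')
  have bAD: "\<bar>A x \<bullet> Du x\<bar> \<le> CA * CD" if "x \<in> \<Omega>" for x
    using mult_mono[OF CA[OF that] CD[OF that]] order_trans[OF norm_ge_zero CA[OF that]]
    by (intro order_trans[OF Cauchy_Schwarz_ineq2]) simp
  \<comment> \<open>The test with \<open>u\<close>, as a limit of tests with
    \<open>\<eta> k * w\<close>: the product rule splits the flux side into the cut-off energy and a
    layer term with weight \<open>w\<close>, which disappears.\<close>
  have energy: "integral \<Omega> (\<lambda>x. A x \<bullet> Du x) = integral \<Omega> (\<lambda>x. f (w x) * w x)"
  proof (rule LIMSEQ_unique)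
    have cfww: "continuous_on \<Omega> (\<lambda>x. f (w x) * w x)" by (intro continuous_on_mult cfw' cw')
    have "\<bar>f (w x) * w x\<bar> \<le> Cf * Cw" if "x \<in> \<Omega>" for x
      unfolding abs_mult using Cf[OF that] Cw[OF that] by (intro mult_mono) auto
    from lim[OF cfww this]
    show "(\<lambda>k. integral \<Omega> (\<lambda>x. \<eta> k x * (f (w x) * w x))) \<longlonglongrightarrow> integral \<Omega> (\<lambda>x. f (w x) * w x)" .
    have "integral \<Omega> (\<lambda>x. \<eta> k x * (f (w x) * w x))
        = integral \<Omega> (\<lambda>x. \<eta> k x * (A x \<bullet> Du x)) + integral \<Omega> (\<lambda>x. w x * (A x \<bullet> grad (\<eta> k) x))" for k
    proof -
      note t = test_fun_times[OF dom(1) \<eta>(1)[of k] cDu' dw]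
      have "integral \<Omega> (\<lambda>x. \<eta> k x * (f (w x) * w x)) = integral \<Omega> (\<lambda>x. f (u x) * (\<eta> k x * w x))"
        using ae[of "\<lambda>t x. f t * (\<eta> k x * w x)"] by (simp add: mult_ac)
      also have "\<dots> = integral \<Omega> (\<lambda>x. A x \<bullet> grad (\<lambda>x. \<eta> k x * w x) x)"
        using weq[OF t(1)] by simp
      also have "\<dots> = integral \<Omega> (\<lambda>x. \<eta> k x * (A x \<bullet> Du x) + w x * (A x \<bullet> grad (\<eta> k) x))"
        by (rule integral_cong) (simp add: t(2) inner_add_right)
      also have "\<dots> = integral \<Omega> (\<lambda>x. \<eta> k x * (A x \<bullet> Du x)) + integral \<Omega> (\<lambda>x. w x * (A x \<bullet> grad (\<eta> k) x))"
      proof (rule integral_add)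
        have b: "\<bar>\<eta> k x * (A x \<bullet> Du x)\<bar> \<le> CA * CD" if "x \<in> \<Omega>" for x
          using mult_mono[OF \<eta>(3)[of k x] bAD[OF that]] \<eta>(2)[of k x] by (simp add: abs_mult)
        show "(\<lambda>x. \<eta> k x * (A x \<bullet> Du x)) integrable_on \<Omega>"
          by (rule int[OF bounded_continuous_imp_absolutely_integrable[OF lm, where B = "CA * CD"]])
             (use b in \<open>auto intro!: continuous_on_mult c\<eta> cAD\<close>)
        have "continuous_on (closure \<Omega>) (grad (\<eta> k))"
          using \<eta>(1)[of k] unfolding test_fun_def by (auto intro: continuous_on_subset)
        then have "continuous_on (closure \<Omega>) (\<lambda>x. w x * (A x \<bullet> grad (\<eta> k) x))"
          by (intro continuous_on_mult continuous_on_inner cw cA)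
        moreover from bdd[OF this] obtain B where "\<And>x. x \<in> \<Omega> \<Longrightarrow> norm (w x * (A x \<bullet> grad (\<eta> k) x)) \<le> B"
          by blast
        ultimately show "(\<lambda>x. w x * (A x \<bullet> grad (\<eta> k) x)) integrable_on \<Omega>"
          by (intro int[OF bounded_continuous_imp_absolutely_integrable[OF lm]])
             (auto intro: continuous_on_subset[OF _ closure_subset])
      qed
      finally show ?thesis .
    qed
    then show "(\<lambda>k. integral \<Omega> (\<lambda>x. \<eta> k x * (f (w x) * w x))) \<longlonglongrightarrow> integral \<Omega> (\<lambda>x. A x \<bullet> Du x)"
      using tendsto_add[OF lim[OF cAD bAD] layer[OF cw' Cw]] by simp
  qed

  obtain t0 where t0: "\<And>t. 0 < t \<Longrightarrow> t \<le> M \<Longrightarrow> f t * (t - t0) \<le> 0"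
    using sign_change_threshold[OF fmono, of M] by blast
  have i1: "(\<lambda>x. f (w x)) integrable_on \<Omega>"
    by (rule int[OF bounded_continuous_imp_absolutely_integrable[OF lm cfw', of Cf]]) (use Cf in simp)
  have i2: "(\<lambda>x. f (w x) * w x) integrable_on \<Omega>"
  proof (rule int[OF bounded_continuous_imp_absolutely_integrable[OF lm, of _ "Cf * Cw"]])
    show "norm (f (w x) * w x) \<le> Cf * Cw" if "x \<in> \<Omega>" for x
      unfolding real_norm_def abs_mult using Cf[OF that] Cw[OF that] by (intro mult_mono) auto
  qed (intro continuous_on_mult cfw' cw')
  have i3: "(\<lambda>x. f (w x) * (w x - t0)) integrable_on \<Omega>"
    using integrable_diff[OF i2 integrable_on_mult_left[OF i1, of t0]] by (simp add: algebra_simps)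
  have "integral \<Omega> (\<lambda>x. A x \<bullet> Du x) = integral \<Omega> (\<lambda>x. f (w x) * w x) - integral \<Omega> (\<lambda>x. f (w x) * t0)"
    using energy f_zero by simp
  also have "\<dots> = integral \<Omega> (\<lambda>x. f (w x) * (w x - t0))"
    using integral_diff[OF i2 integrable_on_mult_left[OF i1, of t0]] by (simp add: algebra_simps)
  \<comment> \<open>Back from \<open>w\<close> to \<open>u\<close>, because positivity and the bound
    \<open>M\<close> are given at every point for \<open>u\<close>, while \<open>w\<close> inherits
    them here only almost everywhere.\<close>
  also have "\<dots> = integral \<Omega> (\<lambda>x. f (u x) * (u x - t0))"
    using ae[of "\<lambda>t x. f t * (t - t0)"] by simp
  also have "\<dots> \<le> integral \<Omega> (\<lambda>x. 0)"
  proof (rule integral_le)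
    show "(\<lambda>x. f (u x) * (u x - t0)) integrable_on \<Omega>"
      by (rule integrable_spike[OF i3 uw]) auto
    show "f (u x) * (u x - t0) \<le> 0" if "x \<in> \<Omega>" for x
      using t0 upos[OF that] M[OF that] by auto
  qed (rule integrable_on_const[OF lm])
  finally have le: "integral \<Omega> (\<lambda>x. A x \<bullet> Du x) \<le> 0" by simp
  have AD: "A x \<bullet> Du x = H (Du x) powr p" for x
    unfolding A_def by (rule afield_inner_self[OF Hnorm H2C11 p(1)])
  \<comment> \<open>The energy density is continuous and nonnegative with integral at most 0, so it
    vanishes at every point; the gauge is positive away from 0.\<close>
  have "Du x = 0" if "x \<in> \<Omega>" for x
  proof -
    have "A x \<bullet> Du x = 0"
    proof (rule integral_zero_continuous_nonneg[OF dom(1) cAD _ _ le that])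
      show "(\<lambda>x. A x \<bullet> Du x) integrable_on \<Omega>"
        by (rule int[OF bounded_continuous_imp_absolutely_integrable[OF lm cAD, of "CA * CD"]]) (use bAD in simp)
    qed (simp add: AD)
    then show ?thesis using gauge_pos[OF Hnorm H2C11 p(1), of "Du x"] by (auto simp: AD)
  qed
  then have "(w has_derivative (\<lambda>s. 0)) (at x within \<Omega>)" if "x \<in> \<Omega>" for x
    using dw[OF that] that by (simp add: has_derivative_at_withinI)
  then obtain c where "\<And>x. x \<in> \<Omega> \<Longrightarrow> w x = c"
    using has_derivative_zero_constant[OF dom(5)] by blast
  then have "{x \<in> \<Omega>. u x \<noteq> c} \<subseteq> {x \<in> \<Omega>. u x \<noteq> w x}" by auto
  then show ?thesis using uw negligible_subset by blast
qed

end
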